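(* Let $$N=\frac{\mathbb{R}^3}{(t+1,x,y)\sim(t,x,x+y),\ (t,x+1,y)\sim(t,x,y+1)\sim(t,x,y)},$$ let $X=(\mathbb{R}/\mathbb{Z})\times N$, let $Y=\{0\}\times N\subset X$, and let $p\colon Y\to T^2=(\mathbb{R}/\mathbb{Z})^2$ be the projection $(t,x,y)\mapsto(t,x)$ (a principal $S^1$-bundle for the additive action of $\mathbb{R}/\mathbb{Z}$ on the $y$ coordinate). Then there is no symplectic form $\tilde{\omega}$ on $X$ such that $\tilde{\omega}|_Y$ is the pullback by $p$ of a symplectic form on $T^2$.
   Context: $N$ is the mapping torus of the map $(x,y)\mapsto(x,x+y)$ of $T^2=(\mathbb{R}/\mathbb{Z})^2$, and $X$ is the Kodaira--Thurston manifold. $\tilde{\omega}|_Y$ denotes the pullback of $\tilde{\omega}$ to $Y$ under inclusion. *)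

theory Defs
  imports "HOL-Analysis.Analysis"
begin

section \<open>Smooth maps between open subsets of normed spaces\<close>

primrec Ck_on ::
  "nat \<Rightarrow> 'a::real_normed_vector set \<Rightarrow> ('a \<Rightarrow> 'b::real_normed_vector) \<Rightarrow> bool" where
  "Ck_on 0 S f = continuous_on S f"
| "Ck_on (Suc k) S f =
     ((\<forall>x\<in>S. f differentiable at x) \<and> (\<forall>v. Ck_on k S (\<lambda>x. frechet_derivative f (at x) v)))"

text \<open>Only meant for open \<open>S\<close>.\<close>

definition smooth_on :: "'a::real_normed_vector set \<Rightarrow> ('a \<Rightarrow> 'b::real_normed_vector) \<Rightarrow> bool" where
  "smooth_on S f \<longleftrightarrow> (\<forall>k. Ck_on k S f)"


section \<open>Smooth manifolds given by local parametrizations\<close>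

text \<open>
  A chart is recorded by its inverse: \<open>(U, \<phi>)\<close> is an injective parametrization \<open>\<phi>\<close> of a piece of
  the manifold by an open subset \<open>U\<close> of the Euclidean model space. The values of \<open>\<phi>\<close> outside \<open>U\<close>
  are irrelevant.
\<close>

type_synonym ('e, 'm) chart = "'e set \<times> ('e \<Rightarrow> 'm)"

definition smooth_atlas :: "'m set \<Rightarrow> ('e::euclidean_space, 'm) chart set \<Rightarrow> bool" where
  "smooth_atlas M A \<longleftrightarrow>
     (\<forall>(U, \<phi>)\<in>A. open U \<and> inj_on \<phi> U) \<and>
     (\<Union>(U, \<phi>)\<in>A. \<phi> ` U) = M \<and>
     (\<forall>(U, \<phi>)\<in>A. \<forall>(V, \<psi>)\<in>A.
        open (U \<inter> \<phi> -` (\<psi> ` V)) \<and> smooth_on (U \<inter> \<phi> -` (\<psi> ` V)) (inv_into V \<psi> \<circ> \<phi>))"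

text \<open>The charts of a quotient of a Euclidean space by a discrete group: restrictions of the
  quotient map to open sets on which it is injective.\<close>

definition quotient_atlas :: "('e::euclidean_space \<Rightarrow> 'm) \<Rightarrow> ('e, 'm) chart set" where
  "quotient_atlas q = {(U, q) | U. open U \<and> inj_on q U}"

definition prod_atlas ::
  "('e, 'm) chart set \<Rightarrow> ('f, 'n) chart set \<Rightarrow> ('e \<times> 'f, 'm \<times> 'n) chart set" where
  "prod_atlas A B = {(U \<times> V, map_prod \<phi> \<psi>) | U \<phi> V \<psi>. (U, \<phi>) \<in> A \<and> (V, \<psi>) \<in> B}"

text \<open>Transport of a smooth structure along an injective map, onto the range of that map.\<close>

definition image_atlas :: "('m \<Rightarrow> 'n) \<Rightarrow> ('e, 'm) chart set \<Rightarrow> ('e, 'n) chart set" where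
  "image_atlas j A = {(U, j \<circ> \<phi>) | U \<phi>. (U, \<phi>) \<in> A}"


section \<open>Differential 2-forms and symplectic forms\<close>

text \<open>A field of bilinear forms on (an open subset of) the model space.\<close>

type_synonym 'e local_form = "'e \<Rightarrow> 'e \<Rightarrow> 'e \<Rightarrow> real"

definition local_pullback ::
  "('e::real_normed_vector \<Rightarrow> 'f::real_normed_vector) \<Rightarrow> 'f local_form \<Rightarrow> 'e local_form" where
  "local_pullback G \<alpha> =
     (\<lambda>x u v. \<alpha> (G x) (frechet_derivative G (at x) u) (frechet_derivative G (at x) v))"

text \<open>The exterior derivative, evaluated on constant vector fields \<open>u, v, w\<close>
  (whose Lie brackets vanish).\<close>

definition local_ext_deriv :: "'e::real_normed_vector local_form \<Rightarrow> 'e \<Rightarrow> 'e \<Rightarrow> 'e \<Rightarrow> 'e \<Rightarrow> real" where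
  "local_ext_deriv \<alpha> x u v w =
     frechet_derivative (\<lambda>z. \<alpha> z v w) (at x) u
   - frechet_derivative (\<lambda>z. \<alpha> z u w) (at x) v
   + frechet_derivative (\<lambda>z. \<alpha> z u v) (at x) w"

text \<open>A 2-form on a manifold is given by its local expressions in all charts of the atlas; the
  local expression in \<open>(U, \<phi>)\<close> is only meaningful at points of \<open>U\<close>, see \<open>form_eq\<close>.\<close>

type_synonym ('e, 'm) form = "('e, 'm) chart \<Rightarrow> 'e local_form"

definition two_form :: "('e::euclidean_space, 'm) chart set \<Rightarrow> ('e, 'm) form \<Rightarrow> bool" where
  "two_form A \<omega> \<longleftrightarrow>
     (\<forall>(U, \<phi>)\<in>A.
        (\<forall>x\<in>U. bilinear (\<omega> (U, \<phi>) x) \<and> (\<forall>u. \<omega> (U, \<phi>) x u u = 0)) \<and>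
        (\<forall>u v. smooth_on U (\<lambda>x. \<omega> (U, \<phi>) x u v))) \<and>
     (\<forall>(U, \<phi>)\<in>A. \<forall>(V, \<psi>)\<in>A. \<forall>x \<in> U \<inter> \<phi> -` (\<psi> ` V).
        \<omega> (U, \<phi>) x = local_pullback (inv_into V \<psi> \<circ> \<phi>) (\<omega> (V, \<psi>)) x)"

definition closed_form :: "('e::euclidean_space, 'm) chart set \<Rightarrow> ('e, 'm) form \<Rightarrow> bool" where
  "closed_form A \<omega> \<longleftrightarrow>
     (\<forall>(U, \<phi>)\<in>A. \<forall>x\<in>U. \<forall>u v w. local_ext_deriv (\<omega> (U, \<phi>)) x u v w = 0)"

definition nondegenerate_form :: "('e::euclidean_space, 'm) chart set \<Rightarrow> ('e, 'm) form \<Rightarrow> bool" where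
  "nondegenerate_form A \<omega> \<longleftrightarrow>
     (\<forall>(U, \<phi>)\<in>A. \<forall>x\<in>U. \<forall>u. (\<forall>v. \<omega> (U, \<phi>) x u v = 0) \<longrightarrow> u = 0)"

definition symplectic_form :: "('e::euclidean_space, 'm) chart set \<Rightarrow> ('e, 'm) form \<Rightarrow> bool" where
  "symplectic_form A \<omega> \<longleftrightarrow> two_form A \<omega> \<and> closed_form A \<omega> \<and> nondegenerate_form A \<omega>"

definition form_eq :: "('e, 'm) chart set \<Rightarrow> ('e, 'm) form \<Rightarrow> ('e, 'm) form \<Rightarrow> bool" where
  "form_eq A \<eta> \<theta> \<longleftrightarrow> (\<forall>(U, \<phi>)\<in>A. \<forall>x\<in>U. \<eta> (U, \<phi>) x = \<theta> (U, \<phi>) x)"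

text \<open>The pullback along \<open>F\<close> of a form on a manifold with atlas \<open>B\<close>: near the point with
  coordinate \<open>x\<close> express \<open>F\<close> in some chart of \<open>B\<close> around its image point. By the compatibility
  condition in \<open>two_form\<close> the result does not depend on the choice.\<close>

definition form_pullback ::
  "('f::euclidean_space, 'n) chart set \<Rightarrow> ('m \<Rightarrow> 'n) \<Rightarrow> ('f, 'n) form \<Rightarrow>
   ('e::euclidean_space, 'm) form" where
  "form_pullback B F \<omega> = (\<lambda>(U, \<phi>) x.
     let (V, \<psi>) = (SOME c. c \<in> B \<and> F (\<phi> x) \<in> snd c ` fst c)
     in local_pullback (inv_into V \<psi> \<circ> F \<circ> \<phi>) (\<omega> (V, \<psi>)) x)"


section \<open>The spaces \<open>\<real>/\<int>\<close>, \<open>N\<close>, \<open>X\<close>, \<open>Y\<close> and the projection\<close>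

definition circle_rel :: "real \<Rightarrow> real \<Rightarrow> bool" where
  "circle_rel s t \<longleftrightarrow> s - t \<in> \<int>"

lemma equivp_circle_rel: "equivp circle_rel"
proof (rule equivpI)
  show "reflp circle_rel" by (simp add: reflp_def circle_rel_def)
  show "symp circle_rel"
    by (metis Ints_minus circle_rel_def minus_diff_eq symp_def)
  show "transp circle_rel"
    unfolding transp_def circle_rel_def
    by (metis Ints_add add_diff_eq diff_add_cancel)
qed

quotient_type circle = real / circle_rel
  by (rule equivp_circle_rel)

inductive N_gluing :: "real \<times> real \<times> real \<Rightarrow> real \<times> real \<times> real \<Rightarrow> bool" where
  "N_gluing (t + 1, x, y) (t, x, x + y)"
| "N_gluing (t, x + 1, y) (t, x, y)"
| "N_gluing (t, x, y + 1) (t, x, y)"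

quotient_type N = "real \<times> real \<times> real" / "equivclp N_gluing"
  by simp

lift_definition N_proj :: "N \<Rightarrow> circle \<times> circle"
  is "\<lambda>(t, x, y). (abs_circle t, abs_circle x)"
proof -
  have step: "(case a of (t, x, y) \<Rightarrow> (abs_circle t, abs_circle x)) =
              (case b of (t, x, y) \<Rightarrow> (abs_circle t, abs_circle x))"
    if "N_gluing a b" for a b
    using that by cases (simp_all add: circle.abs_eq_iff circle_rel_def)
  show "(case a of (t, x, y) \<Rightarrow> (abs_circle t, abs_circle x)) =
        (case b of (t, x, y) \<Rightarrow> (abs_circle t, abs_circle x))"
    if "equivclp N_gluing a b" for a b
    using that by (induction rule: equivclp_induct) (metis step)+
qed

definition circle_atlas :: "(real, circle) chart set" where
  "circle_atlas = quotient_atlas abs_circle"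

definition T2_atlas :: "(real \<times> real, circle \<times> circle) chart set" where
  "T2_atlas = prod_atlas circle_atlas circle_atlas"

definition N_atlas :: "(real \<times> real \<times> real, N) chart set" where
  "N_atlas = quotient_atlas abs_N"

text \<open>\<open>X\<close> is the whole type \<open>circle \<times> N\<close>.\<close>

definition X_atlas :: "(real \<times> real \<times> real \<times> real, circle \<times> N) chart set" where
  "X_atlas = prod_atlas circle_atlas N_atlas"

definition Y :: "(circle \<times> N) set" where
  "Y = {abs_circle 0} \<times> UNIV"

definition Y_atlas :: "(real \<times> real \<times> real, circle \<times> N) chart set" where
  "Y_atlas = image_atlas (Pair (abs_circle 0)) N_atlas"

text \<open>The inclusion of \<open>Y\<close> into \<open>X\<close> and the bundle projection on \<open>Y\<close>; only their values at
  points of \<open>Y\<close> matter.\<close>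

definition Y_incl :: "circle \<times> N \<Rightarrow> circle \<times> N" where
  "Y_incl q = q"

definition Y_proj :: "circle \<times> N \<Rightarrow> circle \<times> circle" where
  "Y_proj q = N_proj (snd q)"


section \<open>The atlases are smooth atlases\<close>

lemma Ck_on_cong:
  fixes f g :: "'a::real_normed_vector \<Rightarrow> 'b::real_normed_vector"
  assumes "open S" "\<And>x. x \<in> S \<Longrightarrow> f x = g x" "Ck_on k S f"
  shows "Ck_on k S g"
  using assms(2,3)
proof (induction k arbitrary: f g)
  case 0
  then show ?case by (simp cong: continuous_on_cong)
next
  case (Suc k)
  have d: "(g has_derivative frechet_derivative f (at x)) (at x)" if "x \<in> S" for x
  proof (rule has_derivative_transform_within_open[of f _ x UNIV S])
    show "(f has_derivative frechet_derivative f (at x)) (at x)"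
      using Suc.prems(2) that by (simp add: frechet_derivative_works)
  qed (use assms(1) that Suc.prems(1) in auto)
  then have e: "frechet_derivative g (at x) = frechet_derivative f (at x)" if "x \<in> S" for x
    using that frechet_derivative_at by metis
  have "g differentiable at x" if "x \<in> S" for x
    using d[OF that] differentiable_def by blast
  moreover have "Ck_on k S (\<lambda>x. frechet_derivative g (at x) v)" for v
    by (rule Suc.IH[of "\<lambda>x. frechet_derivative f (at x) v"]) (use e Suc.prems(2) in auto)
  ultimately show ?case by simp
qed

lemma Ck_on_local:
  assumes "open S" "\<And>x. x \<in> S \<Longrightarrow> \<exists>T. open T \<and> x \<in> T \<and> Ck_on k T f"
  shows "Ck_on k S f"
  using assms(2)
proof (induction k arbitrary: f)
  case 0
  then show ?case
    by (metis Ck_on.simps(1) assms(1) continuous_at_imp_continuous_on continuous_on_eq_continuous_at)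
next
  case (Suc k)
  have "f differentiable at x" if "x \<in> S" for x
    using Suc.prems[OF that] by auto
  moreover have "Ck_on k S (\<lambda>x. frechet_derivative f (at x) v)" for v
    by (rule Suc.IH) (use Suc.prems in force)
  ultimately show ?case by simp
qed

lemma Ck_on_const: "Ck_on k S (\<lambda>x. c)"
  by (induction k arbitrary: c) auto

lemma Ck_on_affine:
  assumes "bounded_linear L"
  shows "Ck_on k S (\<lambda>x. L x + c)"
proof -
  have d: "((\<lambda>x. L x + c) has_derivative L) (at x)" for x
    by (rule has_derivative_add_const[OF bounded_linear_imp_has_derivative[OF assms]])
  then have "frechet_derivative (\<lambda>x. L x + c) (at x) = L" for x
    using frechet_derivative_at by metis
  moreover have "(\<lambda>x. L x + c) differentiable at x" for x
    using d differentiable_def by blast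
  moreover have "continuous_on S (\<lambda>x. L x + c)"
    using assms by (intro continuous_intros linear_continuous_on)
  ultimately show ?thesis by (cases k) (auto simp: Ck_on_const)
qed

lemma Ck_on_map_prod:
  assumes "open S" "open T" "Ck_on k S f" "Ck_on k T g"
  shows "Ck_on k (S \<times> T) (map_prod f g)"
  using assms(3,4)
proof (induction k arbitrary: f g)
  case 0
  then have "continuous_on (S \<times> T) (\<lambda>z. f (fst z))" "continuous_on (S \<times> T) (\<lambda>z. g (snd z))"
    by (auto intro!: continuous_on_compose2[of S f _ fst] continuous_on_compose2[of T g _ snd]
        continuous_on_fst continuous_on_snd continuous_on_id)
  then show ?case
    unfolding map_prod_def Ck_on.simps case_prod_beta by (rule continuous_on_Pair)
next
  case (Suc k)
  have d: "(map_prod f g has_derivative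
      (\<lambda>v. (frechet_derivative f (at (fst z)) (fst v), frechet_derivative g (at (snd z)) (snd v)))) (at z)"
    if "z \<in> S \<times> T" for z
  proof -
    have f: "(f has_derivative frechet_derivative f (at (fst z))) (at (fst z))"
      and g: "(g has_derivative frechet_derivative g (at (snd z))) (at (snd z))"
      using that Suc.prems by (auto simp: frechet_derivative_works)
    have "((\<lambda>z. f (fst z)) has_derivative (\<lambda>v. frechet_derivative f (at (fst z)) (fst v))) (at z)"
      by (rule has_derivative_compose[OF has_derivative_fst[OF has_derivative_ident] f])
    moreover have "((\<lambda>z. g (snd z)) has_derivative (\<lambda>v. frechet_derivative g (at (snd z)) (snd v))) (at z)"
      by (rule has_derivative_compose[OF has_derivative_snd[OF has_derivative_ident] g])
    ultimately show ?thesis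
      unfolding map_prod_def case_prod_beta by (rule has_derivative_Pair)
  qed
  then have e: "frechet_derivative (map_prod f g) (at z) v =
      map_prod (\<lambda>x. frechet_derivative f (at x) (fst v)) (\<lambda>y. frechet_derivative g (at y) (snd v)) z"
    if "z \<in> S \<times> T" for z v
    unfolding frechet_derivative_at[OF d[OF that], symmetric] by (simp add: map_prod_def case_prod_beta)
  have "map_prod f g differentiable at z" if "z \<in> S \<times> T" for z
    using d[OF that] differentiable_def by blast
  moreover have "Ck_on k (S \<times> T) (\<lambda>z. frechet_derivative (map_prod f g) (at z) v)" for v
  proof (rule Ck_on_cong)
    show "Ck_on k (S \<times> T) (map_prod (\<lambda>x. frechet_derivative f (at x) (fst v))
                                     (\<lambda>y. frechet_derivative g (at y) (snd v)))"
      by (rule Suc.IH) (use Suc.prems in auto)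
  qed (use assms e in \<open>auto simp: open_Times\<close>)
  ultimately show ?case by simp
qed

lemma smooth_atlasI:
  assumes "\<And>U \<phi>. (U, \<phi>) \<in> A \<Longrightarrow> open U \<and> inj_on \<phi> U"
    and "(\<Union>(U, \<phi>)\<in>A. \<phi> ` U) = M"
    and "\<And>U \<phi> V \<psi>. (U, \<phi>) \<in> A \<Longrightarrow> (V, \<psi>) \<in> A \<Longrightarrow>
      open (U \<inter> \<phi> -` (\<psi> ` V)) \<and> smooth_on (U \<inter> \<phi> -` (\<psi> ` V)) (inv_into V \<psi> \<circ> \<phi>)"
  shows "smooth_atlas M A"
  using assms unfolding smooth_atlas_def by blast

lemma smooth_atlas_quotient:
  fixes q :: "'e::euclidean_space \<Rightarrow> 'm"
  assumes surj: "surj q"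
    and inj: "\<And>x. \<exists>U. open U \<and> x \<in> U \<and> inj_on q U"
    and deck: "\<And>x y. q x = q y \<Longrightarrow> \<exists>L c. bounded_linear L \<and> (\<forall>z. q (L z + c) = q z) \<and> L x + c = y"
  shows "smooth_atlas UNIV (quotient_atlas q)"
proof -
  have main: "open (U \<inter> q -` (q ` V)) \<and> smooth_on (U \<inter> q -` (q ` V)) (inv_into V q \<circ> q)"
    if U: "open U" "inj_on q U" and V: "open V" "inj_on q V" for U V
  proof -
    have loc: "\<exists>T L c. open T \<and> x \<in> T \<and> T \<subseteq> U \<inter> q -` (q ` V) \<and> bounded_linear L \<and>
                   (\<forall>z\<in>T. (inv_into V q \<circ> q) z = L z + c)"
      if x: "x \<in> U \<inter> q -` (q ` V)" for x
    proof -
      obtain y where y: "y \<in> V" "q x = q y" using x by auto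
      obtain L c where L: "bounded_linear L" "\<And>z. q (L z + c) = q z" "L x + c = y"
        using deck[OF y(2)] by blast
      let ?T = "U \<inter> (\<lambda>z. L z + c) -` V"
      have "open ((\<lambda>z. L z + c) -` V)"
        using L(1) V(1) by (intro open_vimage continuous_intros linear_continuous_on)
      then have "open ?T" using U(1) by auto
      moreover have "x \<in> ?T" using x L(3) y(1) by auto
      moreover have "?T \<subseteq> U \<inter> q -` (q ` V)" using L(2) by (force intro: rev_image_eqI)
      moreover have "\<forall>z\<in>?T. (inv_into V q \<circ> q) z = L z + c"
        using L(2) V(2) by (auto intro!: inv_into_f_eq)
      ultimately show ?thesis using L(1) by blast
    qed
    have o: "open (U \<inter> q -` (q ` V))"
      by (subst open_subopen) (use loc in meson)
    have "Ck_on k (U \<inter> q -` (q ` V)) (inv_into V q \<circ> q)" for k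
    proof (rule Ck_on_local[OF o])
      fix x assume "x \<in> U \<inter> q -` (q ` V)"
      from loc[OF this] obtain T L c where T: "open T" "x \<in> T" "bounded_linear L"
        "\<And>z. z \<in> T \<Longrightarrow> (inv_into V q \<circ> q) z = L z + c" by blast
      have "Ck_on k T (inv_into V q \<circ> q)"
        by (rule Ck_on_cong[OF T(1) _ Ck_on_affine[OF T(3), of k T c]]) (use T(4) in simp)
      then show "\<exists>T. open T \<and> x \<in> T \<and> Ck_on k T (inv_into V q \<circ> q)"
        using T by blast
    qed
    with o show ?thesis by (simp add: smooth_on_def)
  qed
  have "(\<Union>(U, \<phi>)\<in>quotient_atlas q. \<phi> ` U) = UNIV"
  proof -
    have "\<exists>U. open U \<and> inj_on q U \<and> p \<in> q ` U" for p
      using surj inj by (metis image_eqI surjD)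
    then show ?thesis unfolding quotient_atlas_def by fastforce
  qed
  then show ?thesis
    unfolding smooth_atlas_def using main by (auto simp: quotient_atlas_def)
qed

lemma smooth_atlas_prod:
  assumes A: "smooth_atlas M A" and B: "smooth_atlas M' B"
  shows "smooth_atlas (M \<times> M') (prod_atlas A B)"
proof -
  have main: "open (U \<times> U' \<inter> map_prod \<phi> \<phi>' -` (map_prod \<psi> \<psi>' ` (V \<times> V'))) \<and>
    smooth_on (U \<times> U' \<inter> map_prod \<phi> \<phi>' -` (map_prod \<psi> \<psi>' ` (V \<times> V')))
      (inv_into (V \<times> V') (map_prod \<psi> \<psi>') \<circ> map_prod \<phi> \<phi>')"
    if c: "(U, \<phi>) \<in> A" "(V, \<psi>) \<in> A" "(U', \<phi>') \<in> B" "(V', \<psi>') \<in> B" for U \<phi> V \<psi> U' \<phi>' V' \<psi>'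
  proof -
    let ?W = "U \<inter> \<phi> -` (\<psi> ` V)" and ?W' = "U' \<inter> \<phi>' -` (\<psi>' ` V')"
    have W: "open ?W" "smooth_on ?W (inv_into V \<psi> \<circ> \<phi>)" "inj_on \<psi> V"
      using A c(1,2) unfolding smooth_atlas_def by blast+
    have W': "open ?W'" "smooth_on ?W' (inv_into V' \<psi>' \<circ> \<phi>')" "inj_on \<psi>' V'"
      using B c(3,4) unfolding smooth_atlas_def by blast+
    have eq: "U \<times> U' \<inter> map_prod \<phi> \<phi>' -` (map_prod \<psi> \<psi>' ` (V \<times> V')) = ?W \<times> ?W'"
      by force
    have inj: "inj_on (map_prod \<psi> \<psi>') (V \<times> V')"
      using W(3) W'(3) by (rule map_prod_inj_on)
    have val: "map_prod (inv_into V \<psi> \<circ> \<phi>) (inv_into V' \<psi>' \<circ> \<phi>') z =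
        (inv_into (V \<times> V') (map_prod \<psi> \<psi>') \<circ> map_prod \<phi> \<phi>') z" if "z \<in> ?W \<times> ?W'" for z
    proof -
      have "inv_into (V \<times> V') (map_prod \<psi> \<psi>') (map_prod \<phi> \<phi>' z) =
          (inv_into V \<psi> (\<phi> (fst z)), inv_into V' \<psi>' (\<phi>' (snd z)))"
        by (rule inv_into_f_eq[OF inj])
           (use that in \<open>auto simp: inv_into_into f_inv_into_f map_prod_def split: prod.splits\<close>)
      then show ?thesis by (simp add: map_prod_def case_prod_beta)
    qed
    have "Ck_on k (?W \<times> ?W') (inv_into (V \<times> V') (map_prod \<psi> \<psi>') \<circ> map_prod \<phi> \<phi>')" for k
    proof (rule Ck_on_cong[OF _ val])
      show "Ck_on k (?W \<times> ?W') (map_prod (inv_into V \<psi> \<circ> \<phi>) (inv_into V' \<psi>' \<circ> \<phi>'))"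
        by (rule Ck_on_map_prod) (use W W' in \<open>auto simp: smooth_on_def\<close>)
    qed (use W(1) W'(1) in \<open>auto intro: open_Times\<close>)
    then show ?thesis unfolding eq using W(1) W'(1) by (auto simp: smooth_on_def intro: open_Times)
  qed
  have un: "(\<Union>(U, \<phi>)\<in>prod_atlas A B. \<phi> ` U) = (\<Union>(U, \<phi>)\<in>A. \<phi> ` U) \<times> (\<Union>(U, \<phi>)\<in>B. \<phi> ` U)"
    (is "?L = ?R")
  proof
    show "?L \<subseteq> ?R" unfolding prod_atlas_def by fastforce
    show "?R \<subseteq> ?L"
    proof
      fix p assume "p \<in> ?R"
      then obtain U \<phi> x U' \<phi>' x' where h: "(U, \<phi>) \<in> A" "x \<in> U" "(U', \<phi>') \<in> B" "x' \<in> U'"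
        "p = (\<phi> x, \<phi>' x')" by auto
      then have "(U \<times> U', map_prod \<phi> \<phi>') \<in> prod_atlas A B"
        and "p \<in> map_prod \<phi> \<phi>' ` (U \<times> U')" unfolding prod_atlas_def by auto
      then show "p \<in> ?L" by blast
    qed
  qed
  have un': "(\<Union>(U, \<phi>)\<in>A. \<phi> ` U) = M" "(\<Union>(U, \<phi>)\<in>B. \<phi> ` U) = M'"
    using A B unfolding smooth_atlas_def by blast+
  have mem: "\<exists>U \<phi> U' \<phi>'. P = U \<times> U' \<and> \<pi> = map_prod \<phi> \<phi>' \<and> (U, \<phi>) \<in> A \<and> (U', \<phi>') \<in> B"
    if "(P, \<pi>) \<in> prod_atlas A B" for P \<pi>
    using that unfolding prod_atlas_def by blast
  show ?thesis
  proof (rule smooth_atlasI)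
    show "(\<Union>(U, \<phi>)\<in>prod_atlas A B. \<phi> ` U) = M \<times> M'" unfolding un un' ..
  next
    fix P \<pi> assume "(P, \<pi>) \<in> prod_atlas A B"
    from mem[OF this] obtain U \<phi> U' \<phi>' where
      c: "P = U \<times> U'" "\<pi> = map_prod \<phi> \<phi>'" "(U, \<phi>) \<in> A" "(U', \<phi>') \<in> B"
      by (elim exE conjE)
    have "open U" "inj_on \<phi> U" "open U'" "inj_on \<phi>' U'"
      using A B c(3,4) unfolding smooth_atlas_def by blast+
    then show "open P \<and> inj_on \<pi> P" unfolding c(1,2) by (simp add: open_Times map_prod_inj_on)
  next
    fix P \<pi> Q \<rho> assume P: "(P, \<pi>) \<in> prod_atlas A B" and Q: "(Q, \<rho>) \<in> prod_atlas A B"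
    from mem[OF P] obtain U \<phi> U' \<phi>' where
      c: "P = U \<times> U'" "\<pi> = map_prod \<phi> \<phi>'" "(U, \<phi>) \<in> A" "(U', \<phi>') \<in> B"
      by (elim exE conjE)
    from mem[OF Q] obtain V \<psi> V' \<psi>' where
      d: "Q = V \<times> V'" "\<rho> = map_prod \<psi> \<psi>'" "(V, \<psi>) \<in> A" "(V', \<psi>') \<in> B"
      by (elim exE conjE)
    show "open (P \<inter> \<pi> -` (\<rho> ` Q)) \<and> smooth_on (P \<inter> \<pi> -` (\<rho> ` Q)) (inv_into Q \<rho> \<circ> \<pi>)"
      unfolding c(1,2) d(1,2) by (rule main[OF c(3) d(3) c(4) d(4)])
  qed
qed

lemma smooth_atlas_image:
  assumes A: "smooth_atlas M A" and j: "inj j"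
  shows "smooth_atlas (j ` M) (image_atlas j A)"
proof -
  have 1: "(j \<circ> \<phi>) -` ((j \<circ> \<psi>) ` V) = \<phi> -` (\<psi> ` V)" for \<phi> \<psi> :: "'b \<Rightarrow> 'a" and V
    using j by (auto simp: inj_eq)
  have 2: "inv_into V (j \<circ> \<psi>) \<circ> (j \<circ> \<phi>) = inv_into V \<psi> \<circ> \<phi>" for \<phi> \<psi> :: "'b \<Rightarrow> 'a" and V
    using j by (auto simp: inv_into_def inj_eq)
  have 3: "inj_on (j \<circ> \<phi>) U" if "inj_on \<phi> U" for \<phi> :: "'b \<Rightarrow> 'a" and U
    using that j by (meson comp_inj_on inj_on_subset subset_UNIV)
  have 4: "(\<Union>(U, \<phi>)\<in>image_atlas j A. \<phi> ` U) = j ` (\<Union>(U, \<phi>)\<in>A. \<phi> ` U)"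
    unfolding image_atlas_def by (fastforce simp: image_comp)
  show ?thesis
  proof (rule smooth_atlasI)
    show "(\<Union>(U, \<phi>)\<in>image_atlas j A. \<phi> ` U) = j ` M"
      using A unfolding 4 smooth_atlas_def by simp
  next
    fix U \<phi> assume "(U, \<phi>) \<in> image_atlas j A"
    then obtain \<phi>0 where "\<phi> = j \<circ> \<phi>0" "(U, \<phi>0) \<in> A" unfolding image_atlas_def by blast
    then show "open U \<and> inj_on \<phi> U" using A 3 unfolding smooth_atlas_def by blast
  next
    fix U \<phi> V \<psi> assume "(U, \<phi>) \<in> image_atlas j A" "(V, \<psi>) \<in> image_atlas j A"
    then obtain \<phi>0 \<psi>0 where c: "\<phi> = j \<circ> \<phi>0" "(U, \<phi>0) \<in> A" "\<psi> = j \<circ> \<psi>0" "(V, \<psi>0) \<in> A"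
      unfolding image_atlas_def by blast
    show "open (U \<inter> \<phi> -` (\<psi> ` V)) \<and> smooth_on (U \<inter> \<phi> -` (\<psi> ` V)) (inv_into V \<psi> \<circ> \<phi>)"
      unfolding c(1,3) 1 2 using A c(2,4) unfolding smooth_atlas_def by blast
  qed
qed

lemma smooth_atlas_circle: "smooth_atlas UNIV circle_atlas"
  unfolding circle_atlas_def
proof (rule smooth_atlas_quotient)
  show "surj abs_circle"
    by (rule surjI[of _ rep_circle]) (rule Quotient_abs_rep[OF Quotient_circle])
  show "\<exists>U. open U \<and> x \<in> U \<and> inj_on abs_circle U" for x
  proof (intro exI conjI)
    show "inj_on abs_circle {x - 1/4 <..< x + 1/4}"
    proof (rule inj_onI)
      fix s t assume st: "s \<in> {x - 1/4 <..< x + 1/4}" "t \<in> {x - 1/4 <..< x + 1/4}"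
        and "abs_circle s = abs_circle t"
      then obtain k :: int where k: "s - t = of_int k"
        by (auto simp: circle.abs_eq_iff circle_rel_def elim!: Ints_cases)
      then have "\<bar>real_of_int k\<bar> < 1" using st by auto
      then have "k = 0" by linarith
      with k show "s = t" by simp
    qed
  qed auto
  show "\<exists>L c. bounded_linear L \<and> (\<forall>z. abs_circle (L z + c) = abs_circle z) \<and> L x + c = y"
    if "abs_circle x = abs_circle y" for x y
  proof (intro exI conjI)
    show "bounded_linear (\<lambda>z::real. z)" by (rule bounded_linear_ident)
    show "x + (y - x) = y" by simp
    have "y - x \<in> \<int>" using that by (metis Ints_minus circle.abs_eq_iff circle_rel_def minus_diff_eq)
    then show "\<forall>z. abs_circle (z + (y - x)) = abs_circle z"
      by (simp add: circle.abs_eq_iff circle_rel_def)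
  qed
qed

lemma equivclp_N_gluing_shift:
  "equivclp N_gluing (t + of_int k, x + of_int m, y + of_int n - of_int k * x) (t, x, y)"
proof -
  have shift: "equivclp N_gluing (f k) (f 0)"
    if f: "\<And>i. N_gluing (f (i + 1)) (f i)" for f :: "int \<Rightarrow> real \<times> real \<times> real" and k
  proof (induction k rule: int_induct[where k = 0])
    case base
    show ?case by (rule equivp_reflp[OF equivp_evquivclp])
  next
    case (step1 i)
    show ?case by (rule equivclp_trans[OF r_into_equivclp[of N_gluing, OF f[of i]] step1(2)])
  next
    case (step2 i)
    have "N_gluing (f i) (f (i - 1))" using f[of "i - 1"] by simp
    then show ?case using step2(2) by (blast intro: equivclp_trans)
  qed
  have y: "equivclp N_gluing (t, x, y + of_int n) (t, x, y)" for t x y n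
    using shift[of "\<lambda>i. (t, x, y + of_int i)" n] N_gluing.intros(3)
    by (simp add: add.assoc[symmetric])
  have x: "equivclp N_gluing (t, x + of_int m, y) (t, x, y)" for t x y m
    using shift[of "\<lambda>i. (t, x + of_int i, y)" m] N_gluing.intros(2)
    by (simp add: add.assoc[symmetric])
  have t: "equivclp N_gluing (t + of_int k, x, y - of_int k * x) (t, x, y)" for t x y k
  proof -
    have "N_gluing (t + of_int (i + 1), x, y - of_int (i + 1) * x) (t + of_int i, x, y - of_int i * x)" for i
      using N_gluing.intros(1)[of "t + of_int i" x "y - of_int (i + 1) * x"]
      by (simp add: algebra_simps)
    then show ?thesis using shift[of "\<lambda>i. (t + of_int i, x, y - of_int i * x)" k] by simp
  qed
  show ?thesis
    by (rule equivclp_trans[OF x[of "t + of_int k" x m "y + of_int n - of_int k * x"]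
          equivclp_trans[OF t[of t k x "y + of_int n"] y[of t x y n]]])
qed

lemma equivclp_N_gluingE:
  assumes "equivclp N_gluing p (t, x, y)"
  obtains k m n :: int where "p = (t + of_int k, x + of_int m, y + of_int n - of_int k * x)"
proof -
  define R where "R p q \<longleftrightarrow> (\<exists>k m n :: int. fst p = fst q + of_int k \<and>
      fst (snd p) = fst (snd q) + of_int m \<and> snd (snd p) = snd (snd q) + of_int n - of_int k * fst (snd q))"
    for p q :: "real \<times> real \<times> real"
  have R_trans: "R a c" if ab: "R a b" and bc: "R b c" for a b c
  proof -
    obtain k m n :: int where 1: "fst a = fst b + of_int k" "fst (snd a) = fst (snd b) + of_int m"
      "snd (snd a) = snd (snd b) + of_int n - of_int k * fst (snd b)" using ab unfolding R_def by blast
    obtain k' m' n' :: int where 2: "fst b = fst c + of_int k'" "fst (snd b) = fst (snd c) + of_int m'"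
      "snd (snd b) = snd (snd c) + of_int n' - of_int k' * fst (snd c)" using bc unfolding R_def by blast
    show ?thesis unfolding R_def
      by (rule exI[of _ "k + k'"], rule exI[of _ "m + m'"], rule exI[of _ "n + n' - k * m'"])
         (simp add: 1 2 algebra_simps)
  qed
  have R_sym: "R b a" if ab: "R a b" for a b
  proof -
    obtain k m n :: int where 1: "fst a = fst b + of_int k" "fst (snd a) = fst (snd b) + of_int m"
      "snd (snd a) = snd (snd b) + of_int n - of_int k * fst (snd b)" using ab unfolding R_def by blast
    show ?thesis unfolding R_def
      by (rule exI[of _ "- k"], rule exI[of _ "- m"], rule exI[of _ "- n - k * m"])
         (simp add: 1 algebra_simps)
  qed
  have R_step: "R a b" if "N_gluing a b" for a b
    using that
  proof cases
    case (1 t x y)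
    then show ?thesis unfolding R_def
      by (intro exI[of _ 1] exI[of _ 0]) (simp add: exI[of _ 0])
  next
    case (2 t x y)
    then show ?thesis unfolding R_def
      by (intro exI[of _ 0] exI[of _ 1]) auto
  next
    case (3 t x y)
    then show ?thesis unfolding R_def
      by (intro exI[of _ 0] exI[of _ 1]) auto
  qed
  have R_refl: "R a a" for a
    unfolding R_def by (intro exI[of _ "0::int"]) simp
  have "R p (t, x, y)"
    using assms
  proof (induction rule: equivclp_induct)
    case base
    show ?case by (rule R_refl)
  next
    case (step a b)
    then show ?case using R_step R_sym R_trans by metis
  qed
  then show thesis
    unfolding R_def using that by (cases p) auto
qed

lemma smooth_atlas_N: "smooth_atlas UNIV N_atlas"
  unfolding N_atlas_def
proof (rule smooth_atlas_quotient)
  show "surj abs_N"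
    by (rule surjI[of _ rep_N]) (rule Quotient_abs_rep[OF Quotient_N])
  show "\<exists>U. open U \<and> p \<in> U \<and> inj_on abs_N U" for p
  proof -
    obtain a b c where p: "p = (a, b, c)" by (cases p)
    let ?U = "{a - 1/4 <..< a + 1/4} \<times> {b - 1/4 <..< b + 1/4} \<times> {c - 1/4 <..< c + 1/4}"
    have "inj_on abs_N ?U"
    proof (rule inj_onI)
      fix u v assume u: "u \<in> ?U" and v: "v \<in> ?U" and "abs_N u = abs_N v"
      then have "equivclp N_gluing u v" by (simp add: N.abs_eq_iff)
      moreover obtain t x y where vv: "v = (t, x, y)" by (cases v)
      ultimately obtain k m n :: int where uu: "u = (t + of_int k, x + of_int m, y + of_int n - of_int k * x)"
        by (blast elim: equivclp_N_gluingE)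
      have "\<bar>real_of_int k\<bar> < 1" "\<bar>real_of_int m\<bar> < 1"
        using u v unfolding uu vv by (simp_all add: abs_less_iff)
      then have km: "k = 0" "m = 0" by linarith+
      then have "\<bar>real_of_int n\<bar> < 1"
        using u v unfolding uu vv by (simp add: abs_less_iff)
      then have "n = 0" by linarith
      with km show "u = v" using uu vv by simp
    qed
    moreover have "open ?U" by (intro open_Times) auto
    moreover have "p \<in> ?U" by (simp add: p)
    ultimately show ?thesis by blast
  qed
  show "\<exists>L c. bounded_linear L \<and> (\<forall>z. abs_N (L z + c) = abs_N z) \<and> L p + c = q"
    if "abs_N p = abs_N q" for p q
  proof -
    obtain t x y where p: "p = (t, x, y)" by (cases p)
    have "equivclp N_gluing q (t, x, y)" using that p by (simp add: N.abs_eq_iff equivclp_sym)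
    then obtain k m n :: int where q: "q = (t + of_int k, x + of_int m, y + of_int n - of_int k * x)"
      by (rule equivclp_N_gluingE)
    let ?L = "\<lambda>z::real \<times> real \<times> real. (fst z, fst (snd z), snd (snd z) - of_int k * fst (snd z))"
    have "bounded_linear ?L"
      unfolding linear_conv_bounded_linear[symmetric] by (rule linearI) (auto simp: algebra_simps)
    moreover have "abs_N (?L z + (of_int k, of_int m, of_int n)) = abs_N z" for z
      using equivclp_N_gluing_shift[of "fst z" k "fst (snd z)" m "snd (snd z)" n]
      by (simp add: N.abs_eq_iff algebra_simps)
    moreover have "?L p + (of_int k, of_int m, of_int n) = q" by (simp add: p q)
    ultimately show ?thesis by blast
  qed
qed

lemma smooth_atlas_T2: "smooth_atlas UNIV T2_atlas"
  using smooth_atlas_prod[OF smooth_atlas_circle smooth_atlas_circle] by (simp add: T2_atlas_def)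

lemma smooth_atlas_X: "smooth_atlas UNIV X_atlas"
  using smooth_atlas_prod[OF smooth_atlas_circle smooth_atlas_N] by (simp add: X_atlas_def)

lemma smooth_atlas_Y: "smooth_atlas Y Y_atlas"
proof -
  have "range (Pair (abs_circle 0)) = Y" by (auto simp: Y_def)
  then show ?thesis
    using smooth_atlas_image[OF smooth_atlas_N, of "Pair (abs_circle 0)"] by (simp add: Y_atlas_def inj_def)
qed

end

theory Submission
  imports Defs
begin

text \<open>
  If \<open>\<omega>|\<^sub>Y\<close> is pulled back from \<open>T\<^sup>2\<close>, then \<open>[\<omega>|\<^sub>Y] = 0\<close>, because the Euler class of \<open>p\<close> is
  nonzero, and this forces \<open>[\<omega>]\<^sup>2 = 0\<close> on the compact manifold \<open>X\<close>. Concretely, lift \<open>\<omega>\<close> to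
  \<open>\<real>\<^sup>4\<close> and write \<open>\<omega> = ds \<and> \<alpha>\<^sub>s + \<beta>\<^sub>s\<close> with forms \<open>\<alpha>\<^sub>s\<close>, \<open>\<beta>\<^sub>s\<close> on \<open>N\<close> satisfying
  \<open>\<partial>\<^sub>s \<beta>\<^sub>s = d\<alpha>\<^sub>s\<close>. Put \<open>K(v, s) = \<integral> \<alpha>\<^sub>v \<and> \<beta>\<^sub>s\<close> over \<open>N\<close>. By Stokes,
  \<open>\<partial>\<^sub>s K(v, s) = \<integral> \<alpha>\<^sub>v \<and> d\<alpha>\<^sub>s\<close> is symmetric in \<open>v\<close> and \<open>s\<close>. The 1-form
  \<open>a = \<integral> \<alpha>\<^sub>v dv\<close> (over a period) is closed since \<open>\<beta>\<close> is periodic, so its fibre integrals are constant,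
  and in fact zero; as \<open>\<beta>\<^sub>0\<close> comes from the base, \<open>\<integral> K(v, 0) dv = \<integral> a \<and> \<beta>\<^sub>0 = 0\<close>. With
  the symmetry this gives \<open>K(s, s) = 0\<close> for some \<open>s\<close>, and then \<open>\<alpha>\<^sub>s \<and> \<beta>\<^sub>s\<close>, hence \<open>\<omega> \<and> \<omega>\<close>,
  vanishes at some point.
\<close>

section \<open>Directional derivatives and parameter integrals\<close>

definition dir_deriv :: "'a::real_normed_vector \<Rightarrow> ('a \<Rightarrow> real) \<Rightarrow> 'a \<Rightarrow> real" where
  "dir_deriv v f z = deriv (\<lambda>r. f (z + r *\<^sub>R v)) 0"

text \<open>Regularity is required along straight lines, so that the fundamental theorem of calculus
  and the Leibniz rule act on one real variable at a time.\<close>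

definition C1 :: "('a::real_normed_vector \<Rightarrow> real) \<Rightarrow> bool" where
  "C1 f \<longleftrightarrow> continuous_on UNIV f \<and>
     (\<forall>v. continuous_on UNIV (dir_deriv v f) \<and>
          (\<forall>z. ((\<lambda>r. f (z + r *\<^sub>R v)) has_real_derivative dir_deriv v f z) (at 0)))"

lemma C1I:
  assumes "continuous_on UNIV f" "\<And>v. continuous_on UNIV (f' v)"
    and "\<And>v z. ((\<lambda>r. f (z + r *\<^sub>R v)) has_real_derivative f' v z) (at 0)"
  shows "C1 f" and "dir_deriv v f z = f' v z"
proof -
  have *: "dir_deriv v f = f' v" for v
    unfolding dir_deriv_def using assms(3) by (auto intro: DERIV_imp_deriv)
  show "C1 f" "dir_deriv v f z = f' v z" using assms unfolding C1_def * by auto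
qed

lemma C1_continuous: "C1 f \<Longrightarrow> continuous_on S f"
  unfolding C1_def by (meson continuous_on_subset top_greatest)

lemma C1_dir_deriv_continuous: "C1 f \<Longrightarrow> continuous_on S (dir_deriv v f)"
  unfolding C1_def by (meson continuous_on_subset top_greatest)

lemma C1_has_dir_deriv:
  assumes "C1 f"
  shows "((\<lambda>r. f (z + r *\<^sub>R v)) has_real_derivative dir_deriv v f (z + r *\<^sub>R v)) (at r within S)"
proof -
  have "((\<lambda>h. f ((z + r *\<^sub>R v) + h *\<^sub>R v)) has_real_derivative dir_deriv v f (z + r *\<^sub>R v)) (at 0)"
    using assms unfolding C1_def by blast
  also have "(\<lambda>h. f ((z + r *\<^sub>R v) + h *\<^sub>R v)) = (\<lambda>h. (\<lambda>u. f (z + u *\<^sub>R v)) (h + r))"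
    by (simp add: algebra_simps)
  finally have "((\<lambda>r. f (z + r *\<^sub>R v)) has_real_derivative dir_deriv v f (z + r *\<^sub>R v)) (at (0 + r))"
    by (subst DERIV_shift)
  then show ?thesis by (simp add: has_field_derivative_at_within)
qed

lemma
  assumes "C1 f" "C1 g"
  shows C1_add: "C1 (\<lambda>z. f z + g z)"
    and dir_deriv_add: "dir_deriv v (\<lambda>z. f z + g z) z = dir_deriv v f z + dir_deriv v g z"
    and C1_diff: "C1 (\<lambda>z. f z - g z)"
    and dir_deriv_diff: "dir_deriv v (\<lambda>z. f z - g z) z = dir_deriv v f z - dir_deriv v g z"
    and C1_mult: "C1 (\<lambda>z. f z * g z)"
    and dir_deriv_mult: "dir_deriv v (\<lambda>z. f z * g z) z = dir_deriv v f z * g z + f z * dir_deriv v g z"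
proof -
  note c = C1_continuous[OF assms(1)] C1_continuous[OF assms(2)]
    C1_dir_deriv_continuous[OF assms(1)] C1_dir_deriv_continuous[OF assms(2)]
  note d = C1_has_dir_deriv[OF assms(1), of _ _ 0 UNIV, simplified]
    C1_has_dir_deriv[OF assms(2), of _ _ 0 UNIV, simplified]
  note 1 = C1I[of "\<lambda>z. f z + g z" "\<lambda>v z. dir_deriv v f z + dir_deriv v g z"]
  show "C1 (\<lambda>z. f z + g z)" "dir_deriv v (\<lambda>z. f z + g z) z = dir_deriv v f z + dir_deriv v g z"
    by (rule 1; intro continuous_intros c DERIV_add d)+
  note 1 = C1I[of "\<lambda>z. f z - g z" "\<lambda>v z. dir_deriv v f z - dir_deriv v g z"]
  show "C1 (\<lambda>z. f z - g z)" "dir_deriv v (\<lambda>z. f z - g z) z = dir_deriv v f z - dir_deriv v g z"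
    by (rule 1; intro continuous_intros c DERIV_diff d)+
  have m: "((\<lambda>r. f (z + r *\<^sub>R v) * g (z + r *\<^sub>R v)) has_real_derivative
      dir_deriv v f z * g z + f z * dir_deriv v g z) (at 0)" for z v
    using DERIV_mult[OF d(1)[of z v] d(2)[of z v]] by (simp add: mult.commute add.commute)
  note 1 = C1I[of "\<lambda>z. f z * g z" "\<lambda>v z. dir_deriv v f z * g z + f z * dir_deriv v g z"]
  show "C1 (\<lambda>z. f z * g z)"
    "dir_deriv v (\<lambda>z. f z * g z) z = dir_deriv v f z * g z + f z * dir_deriv v g z"
    by (rule 1; intro continuous_intros c m)+
qed

text \<open>Affine maps send lines to lines, so the chain rule is only a change of base point and
  direction.\<close>

lemma
  assumes L: "bounded_linear L" and f: "C1 f"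
  shows C1_compose_affine: "C1 (\<lambda>z. f (c + L z))"
    and dir_deriv_compose_affine: "dir_deriv v (\<lambda>z. f (c + L z)) z = dir_deriv (L v) f (c + L z)"
proof -
  interpret bounded_linear L by (rule L)
  have d: "((\<lambda>r. f (c + L (z + r *\<^sub>R v))) has_real_derivative dir_deriv (L v) f (c + L z)) (at 0)" for z v
    using C1_has_dir_deriv[OF f, of "c + L z" "L v" 0 UNIV] by (simp add: add scaleR add.assoc)
  have c: "continuous_on UNIV (\<lambda>z. g (c + L z))" if "continuous_on UNIV g" for g :: "_ \<Rightarrow> real"
    by (rule continuous_on_compose2[OF that]) (intro continuous_intros linear_continuous_on L, simp)
  note 1 = C1I[of "\<lambda>z. f (c + L z)" "\<lambda>v z. dir_deriv (L v) f (c + L z)"]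
  show "C1 (\<lambda>z. f (c + L z))" "dir_deriv v (\<lambda>z. f (c + L z)) z = dir_deriv (L v) f (c + L z)"
    by (rule 1; rule c[OF C1_continuous[OF f]] c[OF C1_dir_deriv_continuous[OF f]] d)+
qed

lemmas C1_compose_linear = C1_compose_affine[where c = 0, simplified]
lemmas dir_deriv_compose_linear = dir_deriv_compose_affine[where c = 0, simplified]

lemma
  assumes f: "C1 (f :: 'a::real_normed_vector \<times> 'b::real_normed_vector \<Rightarrow> real)"
  shows C1_slice: "C1 (\<lambda>p. f (s, p))"
    and dir_deriv_slice: "dir_deriv v (\<lambda>p. f (s, p)) p = dir_deriv (0, v) f (s, p)"
proof -
  have L: "bounded_linear (\<lambda>p. (0, p) :: 'a \<times> 'b)" by (intro bounded_linear_Pair bounded_linear_zero bounded_linear_ident)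
  show "C1 (\<lambda>p. f (s, p))" "dir_deriv v (\<lambda>p. f (s, p)) p = dir_deriv (0, v) f (s, p)"
    using C1_compose_affine[OF L f, of "(s, 0)"] dir_deriv_compose_affine[OF L f, of v "(s, 0)"] by simp_all
qed

text \<open>On a line in the parameter space this is the Leibniz rule for one real parameter; the
  direction \<open>(v, 0)\<close> leaves the integration variable fixed.\<close>

lemma
  fixes f :: "'a::real_normed_vector \<times> 'b::euclidean_space \<Rightarrow> real"
  assumes f: "C1 f"
  shows C1_integral: "C1 (\<lambda>x. integral (cbox a b) (\<lambda>y. f (x, y)))"
    and dir_deriv_integral: "dir_deriv v (\<lambda>x. integral (cbox a b) (\<lambda>y. f (x, y))) x =
      integral (cbox a b) (\<lambda>y. dir_deriv (v, 0) f (x, y))"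
proof -
  have c: "continuous_on UNIV (\<lambda>x. integral (cbox a b) (\<lambda>y. g (x, y)))"
    if "continuous_on UNIV g" for g :: "'a \<times> 'b \<Rightarrow> real"
    by (rule integral_continuous_on_param) (use that in \<open>auto intro: continuous_on_subset\<close>)
  have d: "((\<lambda>r. integral (cbox a b) (\<lambda>y. f (x + r *\<^sub>R v, y))) has_real_derivative
      integral (cbox a b) (\<lambda>y. dir_deriv (v, 0) f (x, y))) (at 0)" for x v
  proof -
    have 1: "((\<lambda>r. f (x + r *\<^sub>R v, y)) has_real_derivative dir_deriv (v, 0) f (x + r *\<^sub>R v, y)) (at r)" for r y
      using C1_has_dir_deriv[OF f, of "(x, y)" "(v, 0)"] by simp
    have 2: "(\<lambda>y. f (x + r *\<^sub>R v, y)) integrable_on cbox a b" for r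
      by (intro integrable_continuous continuous_on_compose2[OF C1_continuous[OF f, of UNIV]] continuous_intros) auto
    have 3: "continuous_on (UNIV \<times> cbox a b) (\<lambda>(r, y). dir_deriv (v, 0) f (x + r *\<^sub>R v, y))"
      unfolding case_prod_beta
      by (intro continuous_on_compose2[OF C1_dir_deriv_continuous[OF f, of UNIV]] continuous_intros) auto
    have "((\<lambda>r. integral (cbox a b) (\<lambda>y. f (x + r *\<^sub>R v, y))) has_real_derivative
      integral (cbox a b) (\<lambda>y. dir_deriv (v, 0) f (x + 0 *\<^sub>R v, y))) (at 0 within UNIV)"
      by (rule leibniz_rule_field_derivative[where U = UNIV and fx = "\<lambda>r y. dir_deriv (v, 0) f (x + r *\<^sub>R v, y)"])
        (use 1 2 3 in auto)
    then show ?thesis by simp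
  qed
  note 1 = C1I[of "\<lambda>x. integral (cbox a b) (\<lambda>y. f (x, y))" "\<lambda>v x. integral (cbox a b) (\<lambda>y. dir_deriv (v, 0) f (x, y))"]
  show "C1 (\<lambda>x. integral (cbox a b) (\<lambda>y. f (x, y)))"
    "dir_deriv v (\<lambda>x. integral (cbox a b) (\<lambda>y. f (x, y))) x =
      integral (cbox a b) (\<lambda>y. dir_deriv (v, 0) f (x, y))"
    by (rule 1; rule c[OF C1_continuous[OF f]] c[OF C1_dir_deriv_continuous[OF f]] d)+
qed

lemma C1_integral_line:
  assumes "C1 f"
  shows "integral {0..1} (\<lambda>r. dir_deriv v f (z + r *\<^sub>R v)) = f (z + v) - f z"
proof -
  have "((\<lambda>r. dir_deriv v f (z + r *\<^sub>R v)) has_integral (f (z + 1 *\<^sub>R v) - f (z + 0 *\<^sub>R v))) {0..1}"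
    by (rule fundamental_theorem_of_calculus)
      (auto simp: has_real_derivative_iff_has_vector_derivative[symmetric] intro!: C1_has_dir_deriv assms)
  then show ?thesis by (simp add: integral_unique)
qed

text \<open>Here \<open>s\<close> is both the upper limit and a parameter. The two roles are
  separated in \<open>f u x\<close>, differentiated one at a time, and recombined along the
  diagonal.\<close>

lemma has_real_derivative_integral_upto:
  fixes K :: "real \<times> real \<Rightarrow> real"
  assumes K: "C1 K" and s: "s \<in> {0..1}"
  shows "((\<lambda>s. integral {0..s} (\<lambda>v. K (v, s))) has_real_derivative
           K (s, s) + integral {0..s} (\<lambda>v. dir_deriv (0, 1) K (v, s))) (at s within {0..1})"
proof -
  define f where "f u x = integral {0..x} (\<lambda>v. K (v, u))" for u x
  define D where "D = integral {0..s} (\<lambda>v. dir_deriv (0, 1) K (v, s))"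
  have L: "bounded_linear (\<lambda>z :: real \<times> real. (snd z, fst z))"
    by (intro bounded_linear_Pair bounded_linear_fst bounded_linear_snd)
  note K' = C1_compose_linear[OF L K, simplified]
  note dK' = dir_deriv_compose_linear[OF L K, simplified]
  have "((\<lambda>u. f u s) has_real_derivative D) (at s)"
    using C1_has_dir_deriv[OF C1_integral[OF K', of 0 s], of 0 1 s UNIV]
    by (simp add: dir_deriv_integral[OF K', of _ 0 s, simplified] dK' f_def D_def)
  then have fu: "((\<lambda>u. f u s) has_derivative (\<lambda>h. D * h)) (at s within UNIV)"
    by (simp add: has_field_derivative_def)
  have fx: "(f u has_derivative blinfun_mult_right (K (x, u))) (at x within {0..1})"
    if "x \<in> {0..1}" for u x
  proof -
    have "continuous_on {0..1} (\<lambda>v. K (v, u))"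
      by (intro continuous_on_compose2[OF C1_continuous[OF K, of UNIV]] continuous_intros) auto
    from integral_has_real_derivative[OF this that] show ?thesis
      by (simp add: f_def[abs_def] has_field_derivative_def blinfun_mult_right.rep_eq)
  qed
  \<comment> \<open>Continuity of the partial derivative in the upper limit makes the two partial
    derivatives add up to a total one.\<close>
  have c: "continuous_on UNIV (\<lambda>(u, x). blinfun_mult_right (K (x, u)))"
    unfolding case_prod_beta
    by (intro bounded_linear.continuous_on[OF bounded_linear_blinfun_mult_right]
        continuous_on_compose2[OF C1_continuous[OF K, of UNIV]] continuous_intros) auto
  have "((\<lambda>(u, x). f u x) has_derivative
      (\<lambda>(h, k). D * h + blinfun_mult_right (K (s, s)) k)) (at (s, s) within UNIV \<times> {0..1})"
    by (rule has_derivative_partialsI[OF fu fx])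
      (use s c in \<open>auto simp: continuous_on_eq_continuous_within intro: continuous_within_subset\<close>)
  then have F: "((\<lambda>(u, x). f u x) has_derivative (\<lambda>(h, k). D * h + K (s, s) * k))
      (at (s, s) within (\<lambda>u. (u, u)) ` {0..1})"
    unfolding blinfun_mult_right.rep_eq by (rule has_derivative_subset) auto
  have "((\<lambda>u. (\<lambda>(u, x). f u x) (u, u)) has_derivative (\<lambda>h. (\<lambda>(h, k). D * h + K (s, s) * k) (h, h)))
      (at s within {0..1})"
    by (rule has_derivative_in_compose[where f = "\<lambda>u. (u, u)" and f' = "\<lambda>h. (h, h)", OF _ F])
      (intro has_derivative_Pair has_derivative_ident)
  moreover have "(\<lambda>h. (\<lambda>(h, k). D * h + K (s, s) * k) (h, h)) = (*) (K (s, s) + D)"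
    by (simp add: fun_eq_iff algebra_simps)
  ultimately show ?thesis
    by (simp only: has_field_derivative_def case_prod_conv f_def D_def)
qed

lemma
  fixes L :: "'a::real_normed_vector \<Rightarrow> real"
  assumes "bounded_linear L"
  shows C1_bounded_linear: "C1 L" and dir_deriv_bounded_linear: "dir_deriv v L z = L v"
proof -
  have d: "((\<lambda>r. L (z + r *\<^sub>R v)) has_real_derivative L v) (at 0)" for z v
    using assms by (auto simp: linear_simps intro!: derivative_eq_intros)
  note C1I[of L "\<lambda>v z. L v", OF linear_continuous_on[OF assms] continuous_on_const d]
  then show "C1 L" "dir_deriv v L z = L v" by blast+
qed

section \<open>Calculus on the nilmanifold\<close>

text \<open>These are the functions on \<open>N\<close> lifted to the cover; the shift is the deck
  orbit formula of \<open>equivclp_N_gluing_shift\<close>.\<close>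

definition N_invariant :: "(real \<times> real \<times> real \<Rightarrow> real) \<Rightarrow> bool" where
  "N_invariant f \<longleftrightarrow> (\<forall>t x y. \<forall>k m n :: int.
     f (t + of_int k, x + of_int m, y + of_int n - of_int k * x) = f (t, x, y))"

text \<open>The unit cube is a fundamental domain of the deck group.\<close>

abbreviation N_integral :: "(real \<times> real \<times> real \<Rightarrow> real) \<Rightarrow> real" where
  "N_integral \<equiv> integral (cbox (0, 0, 0) (1, 1, 1))"

lemma N_invariantD:
  assumes "N_invariant f"
  shows "f (t + 1, x, y - x) = f (t, x, y)" "f (t, x + 1, y) = f (t, x, y)" "f (t, x, y + 1) = f (t, x, y)"
proof -
  note * = assms[unfolded N_invariant_def, rule_format]
  show "f (t + 1, x, y - x) = f (t, x, y)" using *[of t 1 x 0 y 0] by simp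
  show "f (t, x + 1, y) = f (t, x, y)" using *[of t 0 x 1 y 0] by simp
  show "f (t, x, y + 1) = f (t, x, y)" using *[of t 0 x 0 y 1] by simp
qed

lemma N_integral_iterated:
  assumes "continuous_on UNIV f"
  shows "N_integral f = integral {0..1} (\<lambda>t. integral {0..1} (\<lambda>x. integral {0..1} (\<lambda>y. f (t, x, y))))"
proof -
  have 1: "N_integral f = integral (cbox 0 1) (\<lambda>t. integral (cbox (0, 0) (1, 1)) (\<lambda>z. f (t, z)))"
    by (rule integral_prod_continuous) (rule continuous_on_subset[OF assms], simp)
  have 2: "integral (cbox (0, 0) (1, 1)) (\<lambda>z. f (t, z)) =
      integral (cbox 0 1) (\<lambda>x. integral (cbox 0 1) (\<lambda>y. f (t, x, y)))" for t
    by (rule integral_prod_continuous) (intro continuous_on_compose2[OF assms] continuous_intros, simp)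
  show ?thesis unfolding 1 2 by simp
qed

lemma integral_swap_UNIV:
  fixes f :: "'a::euclidean_space \<times> 'b::euclidean_space \<Rightarrow> real"
  assumes "continuous_on UNIV f"
  shows "integral (cbox a b) (\<lambda>x. integral (cbox c d) (\<lambda>y. f (x, y))) =
         integral (cbox c d) (\<lambda>y. integral (cbox a b) (\<lambda>x. f (x, y)))"
  by (rule integral_swap_continuous) (auto intro: continuous_on_subset[OF assms])

text \<open>A coordinate derivative integrates away only when its variable is innermost; this order
  serves the \<open>x\<close> derivative and the next lemma the \<open>t\<close> derivative.\<close>

lemma N_integral_dx_inner:
  assumes f: "continuous_on UNIV f"
  shows "N_integral f = integral {0..1} (\<lambda>t. integral {0..1} (\<lambda>y. integral {0..1} (\<lambda>x. f (t, x, y))))"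
proof -
  have "integral (cbox 0 1) (\<lambda>x. integral (cbox 0 1) (\<lambda>y. f (t, x, y))) =
      integral (cbox 0 1) (\<lambda>y. integral (cbox 0 1) (\<lambda>x. f (t, x, y)))" for t
    by (rule integral_swap_UNIV[of "\<lambda>z. f (t, z)"])
      (intro continuous_on_compose2[OF f] continuous_intros, simp)
  then show ?thesis by (simp add: N_integral_iterated[OF f])
qed

lemma N_integral_dt_inner:
  assumes f: "continuous_on UNIV f"
  shows "N_integral f = integral {0..1} (\<lambda>x. integral {0..1} (\<lambda>y. integral {0..1} (\<lambda>t. f (t, x, y))))"
proof -
  have "N_integral f = integral (cbox 0 1) (\<lambda>t. integral (cbox (0, 0) (1, 1)) (\<lambda>z. f (t, z)))"
    by (rule integral_prod_continuous) (rule continuous_on_subset[OF f], simp)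
  also have "\<dots> = integral (cbox (0, 0) (1, 1)) (\<lambda>z. integral (cbox 0 1) (\<lambda>t. f (t, z)))"
    by (rule integral_swap_UNIV[OF f])
  also have "\<dots> = integral (cbox 0 1) (\<lambda>x. integral (cbox 0 1) (\<lambda>y. integral (cbox 0 1) (\<lambda>t. f (t, x, y))))"
  proof (rule integral_prod_continuous)
    show "continuous_on (cbox (0, 0) (1, 1)) (\<lambda>z. integral (cbox 0 1) (\<lambda>t. f (t, z)))"
      by (rule integral_continuous_on_param) (auto simp: case_prod_beta intro!: continuous_on_compose2[OF f] continuous_intros)
  qed
  finally show ?thesis by simp
qed

text \<open>The gluing in \<open>t\<close> rotates the fibre over \<open>x\<close> by
  \<open>x\<close>; this lemma shows that such a rotation preserves fibre integrals.\<close>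

lemma integral_periodic_shift:
  fixes f :: "real \<Rightarrow> real"
  assumes f: "continuous_on UNIV f" and per: "\<And>y. f (y + 1) = f y" and r: "0 \<le> r" "r \<le> 1"
  shows "integral {0..1} (\<lambda>y. f (y + r)) = integral {0..1} f"
proof -
  have i: "f integrable_on {a..b}" for a b
    using f by (intro integrable_continuous_interval) (auto intro: continuous_on_subset)
  have sh: "integral {a..b} (\<lambda>y. f (y + c)) = integral {a + c..b + c} f" for a b c
    using integral_shift_real_ivl[of "a + c" c "b + c" f] by simp
  have "integral {0..1} (\<lambda>y. f (y + r)) = integral {r..1 + r} f"
    using sh[of 0 1 r] by simp
  also have "\<dots> = integral {r..1} f + integral {1..1 + r} f"
    using r by (intro Henstock_Kurzweil_Integration.integral_combine[symmetric] i) auto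
  also have "integral {1..1 + r} f = integral {0..r} f"
    using sh[of 0 r 1] by (simp add: per add.commute)
  also have "integral {r..1} f + integral {0..r} f = integral {0..1} f"
    using Henstock_Kurzweil_Integration.integral_combine[of 0 r 1 f] r i by simp
  finally show ?thesis .
qed

text \<open>The invariant frame is divergence free. In \<open>x\<close> and \<open>y\<close> this is
  periodicity; in \<open>t\<close> the boundary values differ by a rotation of the fibre, which
  fibre integrals do not see.\<close>

lemma
  assumes f: "C1 f" and inv: "N_invariant f"
  shows N_integral_ddt: "N_integral (dir_deriv (1, 0, 0) f) = 0"
    and N_integral_ddx: "N_integral (\<lambda>p. dir_deriv (0, 1, 0) f p - fst p * dir_deriv (0, 0, 1) f p) = 0"
    and N_integral_ddy: "N_integral (dir_deriv (0, 0, 1) f) = 0"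
proof -
  note c = C1_dir_deriv_continuous[OF f, of UNIV]
  have y: "integral {0..1} (\<lambda>y. dir_deriv (0, 0, 1) f (t, x, y)) = 0" for t x
    using C1_integral_line[OF f, of "(0, 0, 1)" "(t, x, 0)"] N_invariantD(3)[OF inv, of t x 0] by simp
  have x: "integral {0..1} (\<lambda>x. dir_deriv (0, 1, 0) f (t, x, y)) = 0" for t y
    using C1_integral_line[OF f, of "(0, 1, 0)" "(t, 0, y)"] N_invariantD(2)[OF inv, of t 0 y] by simp
  \<comment> \<open>The gluing identifies the value at \<open>(1, x, y)\<close> with that at
    \<open>(0, x, y + x)\<close>.\<close>
  have t: "integral {0..1} (\<lambda>t. dir_deriv (1, 0, 0) f (t, x, y)) = f (0, x, y + x) - f (0, x, y)" for x y
    using C1_integral_line[OF f, of "(1, 0, 0)" "(0, x, y)"] N_invariantD(1)[OF inv, of 0 x "y + x"] by simp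
  show "N_integral (dir_deriv (0, 0, 1) f) = 0"
    by (simp add: N_integral_iterated[OF c] y)
  have fc: "continuous_on S (\<lambda>y. f (0, x, g y))" if "continuous_on S g" for S x and g :: "real \<Rightarrow> real"
    by (rule continuous_on_compose2[OF C1_continuous[OF f, of UNIV]]) (auto intro!: continuous_intros that)
  have "integral {0..1} (\<lambda>y. f (0, x, y + x) - f (0, x, y)) = 0" if "x \<in> {0..1}" for x
  proof -
    have "integral {0..1} (\<lambda>y. f (0, x, y + x) - f (0, x, y)) =
       integral {0..1} (\<lambda>y. f (0, x, y + x)) - integral {0..1} (\<lambda>y. f (0, x, y))"
      by (intro Henstock_Kurzweil_Integration.integral_diff integrable_continuous_interval fc continuous_intros)
    then show ?thesis
      using integral_periodic_shift[of "\<lambda>y. f (0, x, y)" x] that N_invariantD(3)[OF inv] fc[of UNIV "\<lambda>y. y"]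
      by (simp add: continuous_on_id)
  qed
  then have "integral {0..1} (\<lambda>x. integral {0..1} (\<lambda>y. f (0, x, y + x) - f (0, x, y))) =
      integral {0..1} (\<lambda>x::real. 0 :: real)"
    by (intro integral_cong)
  then show "N_integral (dir_deriv (1, 0, 0) f) = 0"
    by (simp add: N_integral_dt_inner[OF c] t)
  have ty: "continuous_on UNIV (\<lambda>p. fst p * dir_deriv (0, 0, 1) f p)"
    by (intro continuous_intros c)
  have "N_integral (\<lambda>p. dir_deriv (0, 1, 0) f p - fst p * dir_deriv (0, 0, 1) f p) =
      N_integral (dir_deriv (0, 1, 0) f) - N_integral (\<lambda>p. fst p * dir_deriv (0, 0, 1) f p)"
    by (intro Henstock_Kurzweil_Integration.integral_diff integrable_continuous continuous_on_subset[OF c] continuous_on_subset[OF ty]) auto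
  also have "\<dots> = 0"
    by (simp add: N_integral_dx_inner[OF c] x N_integral_iterated[OF ty] y)
  finally show "N_integral (\<lambda>p. dir_deriv (0, 1, 0) f p - fst p * dir_deriv (0, 0, 1) f p) = 0" .
qed

text \<open>The frame \<open>\<partial>\<^sub>t\<close>, \<open>\<partial>\<^sub>x - t \<partial>\<^sub>y\<close>, \<open>\<partial>\<^sub>y\<close> is invariant under the deck group of \<open>N\<close>.\<close>

definition NT :: "(real \<times> real \<times> real \<Rightarrow> real) \<Rightarrow> real \<times> real \<times> real \<Rightarrow> real" where
  "NT f = dir_deriv (1, 0, 0) f"

definition NX :: "(real \<times> real \<times> real \<Rightarrow> real) \<Rightarrow> real \<times> real \<times> real \<Rightarrow> real" where
  "NX f p = dir_deriv (0, 1, 0) f p - fst p * dir_deriv (0, 0, 1) f p"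

definition NY :: "(real \<times> real \<times> real \<Rightarrow> real) \<Rightarrow> real \<times> real \<times> real \<Rightarrow> real" where
  "NY f = dir_deriv (0, 0, 1) f"

lemma N_frame_continuous:
  assumes "C1 f"
  shows "continuous_on S (NT f)" "continuous_on S (NX f)" "continuous_on S (NY f)"
  unfolding NT_def NX_def[abs_def] NY_def
  by (intro continuous_intros C1_dir_deriv_continuous assms)+

lemma N_frame_diff:
  assumes "C1 f" "C1 g"
  shows "NT (\<lambda>p. f p - g p) p = NT f p - NT g p" "NX (\<lambda>p. f p - g p) p = NX f p - NX g p"
    "NY (\<lambda>p. f p - g p) p = NY f p - NY g p"
  by (simp_all add: NT_def NX_def NY_def dir_deriv_diff assms algebra_simps)

lemma N_frame_mult:
  assumes "C1 f" "C1 g"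
  shows "NT (\<lambda>p. f p * g p) p = NT f p * g p + f p * NT g p"
    "NX (\<lambda>p. f p * g p) p = NX f p * g p + f p * NX g p"
    "NY (\<lambda>p. f p * g p) p = NY f p * g p + f p * NY g p"
  by (simp_all add: NT_def NX_def NY_def dir_deriv_mult assms algebra_simps)

lemma N_integral_add:
  assumes "continuous_on UNIV f" "continuous_on UNIV g"
  shows "N_integral (\<lambda>p. f p + g p) = N_integral f + N_integral g"
  by (intro Henstock_Kurzweil_Integration.integral_add integrable_continuous)
    (use assms in \<open>auto intro: continuous_on_subset\<close>)

lemma N_integral_diff:
  assumes "continuous_on UNIV f" "continuous_on UNIV g"
  shows "N_integral (\<lambda>p. f p - g p) = N_integral f - N_integral g"
  by (intro Henstock_Kurzweil_Integration.integral_diff integrable_continuous)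
    (use assms in \<open>auto intro: continuous_on_subset\<close>)

text \<open>Stokes' theorem on \<open>N\<close> for the 2-form with components \<open>u\<close>,
  \<open>v\<close>, \<open>w\<close> in the invariant coframe.\<close>

lemma N_integral_divergence:
  assumes "C1 u" "C1 v" "C1 w" "N_invariant u" "N_invariant v" "N_invariant w"
  shows "N_integral (\<lambda>p. NT u p + NX v p + NY w p) = 0"
proof -
  have "N_integral (NT u) = 0" "N_integral (NX v) = 0" "N_integral (NY w) = 0"
    using N_integral_ddt N_integral_ddx N_integral_ddy assms
    by (auto simp: NT_def NY_def NX_def[abs_def])
  then show ?thesis
    by (simp add: N_integral_add N_frame_continuous assms continuous_on_add)
qed

text \<open>The curl is the exterior derivative in the invariant coframe \<open>dt\<close>, \<open>dx\<close>, \<open>dy + t dx\<close>; the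
  extra term comes from \<open>d (dy + t dx) = dt \<and> dx\<close>.\<close>

definition curl1 where "curl1 a2 a3 p = NX a3 p - NY a2 p"
definition curl2 where "curl2 a1 a3 p = NY a1 p - NT a3 p"
definition curl3 where "curl3 a1 a2 a3 p = NT a2 p - NX a1 p + a3 p"

text \<open>For the 1-forms \<open>a\<close> and \<open>b\<close>, this is Stokes' theorem applied
  to the exact form \<open>d (b \<and> a) = db \<and> a - b \<and> da\<close>.\<close>

lemma N_integral_curl_symmetric:
  assumes a: "C1 a1" "C1 a2" "C1 a3" and b: "C1 b1" "C1 b2" "C1 b3"
    and ia: "N_invariant a1" "N_invariant a2" "N_invariant a3"
    and ib: "N_invariant b1" "N_invariant b2" "N_invariant b3"
  shows "N_integral (\<lambda>p. a1 p * curl1 b2 b3 p + a2 p * curl2 b1 b3 p + a3 p * curl3 b1 b2 b3 p) =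
         N_integral (\<lambda>p. b1 p * curl1 a2 a3 p + b2 p * curl2 a1 a3 p + b3 p * curl3 a1 a2 a3 p)"
    (is "N_integral ?F = N_integral ?G")
proof -
  \<comment> \<open>The components of \<open>b \<and> a\<close>; the products
    \<open>a3 p * b3 p\<close> contributed by \<open>curl3\<close> to the two integrands
    cancel.\<close>
  define u where "u p = a3 p * b2 p - a2 p * b3 p" for p
  define v where "v p = a1 p * b3 p - a3 p * b1 p" for p
  define w where "w p = a2 p * b1 p - a1 p * b2 p" for p
  have "C1 u" "C1 v" "C1 w"
    unfolding u_def[abs_def] v_def[abs_def] w_def[abs_def] by (intro C1_diff C1_mult a b)+
  moreover have "N_invariant u" "N_invariant v" "N_invariant w"
    using ia ib unfolding u_def[abs_def] v_def[abs_def] w_def[abs_def] N_invariant_def by simp_all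
  ultimately have "N_integral (\<lambda>p. NT u p + NX v p + NY w p) = 0"
    by (rule N_integral_divergence)
  also have "(\<lambda>p. NT u p + NX v p + NY w p) = (\<lambda>p. ?F p - ?G p)"
    unfolding u_def[abs_def] v_def[abs_def] w_def[abs_def]
    by (simp add: fun_eq_iff N_frame_diff N_frame_mult C1_mult a b curl1_def curl2_def curl3_def algebra_simps)
  finally have 1: "N_integral (\<lambda>p. ?F p - ?G p) = 0" .
  have c: "continuous_on UNIV ?F" "continuous_on UNIV ?G"
    unfolding curl1_def curl2_def curl3_def
    by (intro continuous_intros N_frame_continuous C1_continuous a b)+
  show ?thesis using N_integral_diff[OF c] 1 by simp
qed

lemma C1_zero_dir_deriv_const:
  assumes "C1 f" "\<And>z. dir_deriv v f z = 0"
  shows "f (z + r *\<^sub>R v) = f z"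
proof -
  have "((\<lambda>r. f (z + r *\<^sub>R v)) has_real_derivative 0) (at r)" for r
    using C1_has_dir_deriv[OF assms(1), of z v r UNIV] assms(2) by simp
  then have "(\<lambda>r. f (z + r *\<^sub>R v)) r = (\<lambda>r. f (z + r *\<^sub>R v)) 0"
    by (intro DERIV_isconst_all) auto
  then show ?thesis by simp
qed

text \<open>The integral over the fibre of a closed invariant 1-form is constant along the base, and
  the constant vanishes because \<open>dt \<and> dx\<close> is exact.\<close>

lemma N_integral_closed_fibre_const:
  assumes a: "C1 a1" "C1 a2" "C1 a3"
    and ia: "N_invariant a1" "N_invariant a2" "N_invariant a3"
    and closed: "\<And>p. curl1 a2 a3 p = 0" "\<And>p. curl2 a1 a3 p = 0" "\<And>p. curl3 a1 a2 a3 p = 0"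
    and c: "continuous_on UNIV c" "\<And>t x y. c (t, x, y) = c (t, x, 0)"
  shows "N_integral (\<lambda>p. c p * a3 p) = 0"
proof -
  \<comment> \<open>The coordinates are regrouped as base \<open>(t, x)\<close> and fibre
    \<open>y\<close>, so that \<open>H\<close> below is the fibre integral as a function on the
    base.\<close>
  define f where "f z = a3 (fst (fst z), snd (fst z), snd z)" for z :: "(real \<times> real) \<times> real"
  have L: "bounded_linear (\<lambda>z :: (real \<times> real) \<times> real. (fst (fst z), snd (fst z), snd z))"
    by (intro bounded_linear_Pair bounded_linear_fst_comp bounded_linear_snd_comp
        bounded_linear_fst bounded_linear_snd)
  have f: "C1 f" and df: "dir_deriv ((v, v'), w) f ((t, x), y) = dir_deriv (v, v', w) a3 (t, x, y)" for v v' w t x y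
    using C1_compose_linear[OF L a(3)] dir_deriv_compose_linear[OF L a(3), of "((v, v'), w)" "((t, x), y)"]
    by (simp_all add: f_def[abs_def])
  define H where "H z = integral (cbox 0 1) (\<lambda>y. f (z, y))" for z
  have H: "C1 H" unfolding H_def[abs_def] by (rule C1_integral[OF f])
  have dH: "dir_deriv (v, v') H (t, x) = integral {0..1} (\<lambda>y. dir_deriv (v, v', 0) a3 (t, x, y))" for v v' t x
    unfolding H_def[abs_def] dir_deriv_integral[OF f] by (simp add: df zero_prod_def)
  \<comment> \<open>Closedness turns both base derivatives of \<open>a3\<close> into fibre
    derivatives, and these integrate to zero over the circle.\<close>
  have Y: "integral {0..1} (\<lambda>y. NY g (t, x, y)) = 0" if "C1 g" "N_invariant g" for g t x
    using C1_integral_line[OF that(1), of "(0, 0, 1)" "(t, x, 0)"] N_invariantD(3)[OF that(2), of t x 0]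
    by (simp add: NY_def)
  have "dir_deriv (1, 0) H z = 0" for z
  proof (cases z)
    case (Pair t x)
    have "dir_deriv (1, 0, 0) a3 (t, x, y) = NY a1 (t, x, y)" for y
      using closed(2)[of "(t, x, y)"] by (simp add: curl2_def NT_def)
    then show ?thesis unfolding Pair dH by (simp add: Y a ia)
  qed
  then have 1: "H (t, x) = H (0, x)" for t x
    using C1_zero_dir_deriv_const[OF H, of "(1, 0)" "(0, x)" t] by simp
  have "dir_deriv (0, 1) H z = 0" for z
  proof (cases z)
    case (Pair t x)
    have "dir_deriv (0, 1, 0) a3 (t, x, y) = NY a2 (t, x, y) + t * NY a3 (t, x, y)" for y
      using closed(1)[of "(t, x, y)"] by (simp add: curl1_def NX_def NY_def)
    moreover have "continuous_on {0..1} (\<lambda>y. NY g (t, x, y))" if "C1 g" for g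
      by (intro continuous_on_compose2[OF N_frame_continuous(3)[OF that, of UNIV]] continuous_intros) simp
    ultimately show ?thesis unfolding Pair dH
      by (simp add: Y a ia Henstock_Kurzweil_Integration.integral_add integrable_continuous_interval
          continuous_on_mult_left)
  qed
  then have 2: "H (0, x) = H (0, 0)" for x
    using C1_zero_dir_deriv_const[OF H, of "(0, 1)" "(0, 0)" x] by simp
  have A: "integral {0..1} (\<lambda>y. a3 (t, x, y)) = H (0, 0)" for t x
    using 1[of t x] 2[of x] by (simp add: H_def f_def)
  \<comment> \<open>Since \<open>curl3\<close> vanishes, \<open>a3\<close> is a combination of frame
    derivatives and has total integral zero; its constant fibre integral is therefore zero.\<close>
  have "N_integral a3 = N_integral (\<lambda>p. NX a1 p - NT a2 p)"
    by (rule integral_cong) (use closed(3) in \<open>simp add: curl3_def algebra_simps\<close>)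
  also have "\<dots> = 0"
    using N_integral_ddt[OF a(2) ia(2)] N_integral_ddx[OF a(1) ia(1)]
    by (simp add: N_integral_diff N_frame_continuous a) (simp add: NT_def NX_def[abs_def])
  finally have "H (0, 0) = 0"
    by (simp add: N_integral_iterated[OF C1_continuous[OF a(3)]] A)
  moreover have "continuous_on UNIV (\<lambda>p. c p * a3 p)"
    by (intro continuous_intros c C1_continuous a)
  moreover have "integral {0..1} (\<lambda>y. c (t, x, y) * a3 (t, x, y)) =
      integral {0..1} (\<lambda>y. c (t, x, 0) * a3 (t, x, y))" for t x
    by (intro integral_cong arg_cong2[of _ _ _ _ "(*)"] c(2) refl)
  ultimately show ?thesis
    by (simp add: N_integral_iterated A)
qed

text \<open>By connectedness \<open>g\<close> has one strict sign, and a continuous function of one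
  strict sign has nonzero integral over the cube.\<close>

lemma N_integral_nonzero:
  assumes c: "continuous_on UNIV g" and nz: "\<And>p. g p \<noteq> 0"
  shows "N_integral g \<noteq> 0"
proof -
  have pos: "N_integral h \<noteq> 0" if "continuous_on UNIV h" "\<And>p. h p > 0" for h :: "real \<times> real \<times> real \<Rightarrow> real"
  proof -
    have "box (0, 0, 0) (1::real, 1::real, 1::real) \<noteq> {}" by (simp add: box_prod box_eq_empty)
    then have "N_integral h = 0 \<longleftrightarrow> (\<forall>p\<in>cbox (0, 0, 0) (1, 1, 1). h p = 0)"
      using that by (intro integral_cbox_eq_0_iff) (auto intro: continuous_on_subset less_imp_le)
    moreover have "(0, 0, 0) \<in> cbox (0, 0, 0) (1::real, 1::real, 1::real)" by simp
    ultimately show ?thesis using that(2) by (metis less_irrefl)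
  qed
  have "connected (range g)" by (rule connected_continuous_image[OF c connected_UNIV])
  then have "0 \<in> range g" if "g p \<le> 0" "0 \<le> g q" for p q
    using that by (blast intro: connectedD_interval[of "range g"])
  then have "g p > 0 \<longleftrightarrow> g q > 0" for p q
    using nz by (metis imageE less_imp_le not_le)
  then consider "\<And>p. g p > 0" | "\<And>p. g p < 0"
    using nz by (metis linorder_neqE_linordered_idom)
  then show ?thesis
  proof cases
    case 1
    then show ?thesis by (rule pos[OF c])
  next
    case 2
    then show ?thesis using pos[of "\<lambda>p. - g p"] c by (simp add: continuous_on_minus)
  qed
qed

section \<open>Vanishing of the Pfaffian\<close>

text \<open>Applied to the components of \<alpha>, this gives the components of the 1-form
  \<open>a\<close> of the overview.\<close>

definition S_average :: "(real \<times> real \<times> real \<times> real \<Rightarrow> real) \<Rightarrow> real \<times> real \<times> real \<Rightarrow> real" where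
  "S_average f p = integral {0..1} (\<lambda>s. f (s, p))"

lemma
  assumes f: "C1 f"
  shows C1_S_average: "C1 (S_average f)"
    and dir_deriv_S_average: "dir_deriv w (S_average f) p =
      integral {0..1} (\<lambda>s. dir_deriv w (\<lambda>p. f (s, p)) p)"
proof -
  have L: "bounded_linear (\<lambda>z :: (real \<times> real \<times> real) \<times> real. (snd z, fst z))"
    by (intro bounded_linear_Pair bounded_linear_fst bounded_linear_snd)
  note f' = C1_compose_linear[OF L f]
  have S: "S_average f = (\<lambda>p. integral (cbox 0 1) (\<lambda>s. f (snd (p, s), fst (p, s))))"
    by (simp add: fun_eq_iff S_average_def)
  show "C1 (S_average f)" unfolding S by (rule C1_integral[OF f'])
  show "dir_deriv w (S_average f) p = integral {0..1} (\<lambda>s. dir_deriv w (\<lambda>p. f (s, p)) p)"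
    unfolding S dir_deriv_integral[OF f'] dir_deriv_compose_linear[OF L f]
    by (simp add: dir_deriv_slice[OF f])
qed

lemma slice_integrable:
  fixes f :: "real \<times> real \<times> real \<times> real \<Rightarrow> real"
  assumes "continuous_on UNIV f"
  shows "(\<lambda>s. f (s, p)) integrable_on {0..1::real}"
  by (intro integrable_continuous_interval continuous_on_compose2[OF assms] continuous_intros) simp

lemma slice_deriv_integrable:
  fixes f :: "real \<times> real \<times> real \<times> real \<Rightarrow> real"
  assumes "C1 f"
  shows "(\<lambda>s. dir_deriv w (\<lambda>p. f (s, p)) p) integrable_on {0..1::real}"
  using slice_integrable[OF C1_dir_deriv_continuous[OF assms, of UNIV "(0, w)"]]
  by (simp add: dir_deriv_slice[OF assms])

text \<open>The frame does not involve the averaged variable \<open>s\<close>, so it commutes with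
  the integral.\<close>

lemma S_average_frame:
  fixes f :: "real \<times> real \<times> real \<times> real \<Rightarrow> real"
  assumes "C1 f"
  shows "NT (S_average f) p = integral {0..1} (\<lambda>s. NT (\<lambda>p. f (s, p)) p)"
    "NX (S_average f) p = integral {0..1} (\<lambda>s. NX (\<lambda>p. f (s, p)) p)"
    "NY (S_average f) p = integral {0..1} (\<lambda>s. NY (\<lambda>p. f (s, p)) p)"
  by (simp_all add: NT_def NX_def NY_def dir_deriv_S_average assms slice_deriv_integrable
      Henstock_Kurzweil_Integration.integral_diff integrable_on_mult_right)

lemma frame_slice_integrable:
  fixes f :: "real \<times> real \<times> real \<times> real \<Rightarrow> real"
  assumes "C1 f"
  shows "(\<lambda>s. NT (\<lambda>p. f (s, p)) p) integrable_on {0..1::real}"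
    "(\<lambda>s. NX (\<lambda>p. f (s, p)) p) integrable_on {0..1::real}"
    "(\<lambda>s. NY (\<lambda>p. f (s, p)) p) integrable_on {0..1::real}"
  by (auto simp: NT_def NX_def NY_def slice_deriv_integrable assms
      intro!: integrable_diff integrable_on_mult_right)

text \<open>The components of \<open>\<omega> = ds \<and> (a\<^sub>1 dt + a\<^sub>2 dx + a\<^sub>3 \<eta>) + b\<^sub>1 dx \<and> \<eta> + b\<^sub>2 \<eta> \<and> dt + b\<^sub>3 dt \<and> dx\<close> with
  \<open>\<eta> = dy + t dx\<close>. Then \<open>\<omega> \<and> \<omega>\<close> is \<open>2 (a\<^sub>1 b\<^sub>1 + a\<^sub>2 b\<^sub>2 + a\<^sub>3 b\<^sub>3)\<close> times the volume form.\<close>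

locale closed_coefficients =
  fixes a1 a2 a3 b1 b2 b3 :: "real \<times> real \<times> real \<times> real \<Rightarrow> real"
  assumes C1: "C1 a1" "C1 a2" "C1 a3" "C1 b1" "C1 b2" "C1 b3"
    and inv: "\<And>s. N_invariant (\<lambda>p. a1 (s, p))" "\<And>s. N_invariant (\<lambda>p. a2 (s, p))"
      "\<And>s. N_invariant (\<lambda>p. a3 (s, p))"
    and per: "\<And>p. b1 (1, p) = b1 (0, p)" "\<And>p. b2 (1, p) = b2 (0, p)" "\<And>p. b3 (1, p) = b3 (0, p)"
    and closed: "\<And>s p. dir_deriv (1, 0) b1 (s, p) = curl1 (\<lambda>p. a2 (s, p)) (\<lambda>p. a3 (s, p)) p"
      "\<And>s p. dir_deriv (1, 0) b2 (s, p) = curl2 (\<lambda>p. a1 (s, p)) (\<lambda>p. a3 (s, p)) p"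
      "\<And>s p. dir_deriv (1, 0) b3 (s, p) = curl3 (\<lambda>p. a1 (s, p)) (\<lambda>p. a2 (s, p)) (\<lambda>p. a3 (s, p)) p"
    and div: "\<And>p. NT (\<lambda>p. b1 (0, p)) p + NX (\<lambda>p. b2 (0, p)) p + NY (\<lambda>p. b3 (0, p)) p = 0"
    and fibre: "\<And>p. b1 (0, p) = 0" "\<And>p. b2 (0, p) = 0"
begin

text \<open>This is \<open>K\<close> of the overview: in the invariant coframe the integrand is the
  coefficient of \<open>\<alpha>\<^sub>v \<and> \<beta>\<^sub>s\<close>.\<close>

definition pairing :: "real \<times> real \<Rightarrow> real" where
  "pairing z = N_integral (\<lambda>p. a1 (fst z, p) * b1 (snd z, p) + a2 (fst z, p) * b2 (snd z, p)
     + a3 (fst z, p) * b3 (snd z, p))"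

lemma
  shows C1_pairing: "C1 pairing"
    and pairing_deriv_eq: "dir_deriv (0, 1) pairing (v, s) =
      N_integral (\<lambda>p. a1 (v, p) * dir_deriv (1, 0) b1 (s, p) + a2 (v, p) * dir_deriv (1, 0) b2 (s, p)
        + a3 (v, p) * dir_deriv (1, 0) b3 (s, p))"
proof -
  have L: "bounded_linear (\<lambda>z :: (real \<times> real) \<times> (real \<times> real \<times> real). (fst (fst z), snd z))"
    "bounded_linear (\<lambda>z :: (real \<times> real) \<times> (real \<times> real \<times> real). (snd (fst z), snd z))"
    by (intro bounded_linear_Pair bounded_linear_fst_comp bounded_linear_snd_comp
        bounded_linear_fst bounded_linear_snd)+
  \<comment> \<open>The direction \<open>((0, w), 0)\<close> does not move the first circle
    variable, so the factors \<open>a1\<close>, \<open>a2\<close>, \<open>a3\<close> count as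
    constants.\<close>
  have a: "C1 (\<lambda>z :: (real \<times> real) \<times> (real \<times> real \<times> real). f (fst (fst z), snd z))"
    "dir_deriv ((0, w), 0) (\<lambda>z. f (fst (fst z), snd z)) z = 0"
    if "C1 f" for f :: "real \<times> real \<times> real \<times> real \<Rightarrow> real" and w and z :: "(real \<times> real) \<times> (real \<times> real \<times> real)"
  proof -
    show "C1 (\<lambda>z :: (real \<times> real) \<times> (real \<times> real \<times> real). f (fst (fst z), snd z))" by (rule C1_compose_linear[OF L(1) that])
    have "dir_deriv 0 f x = 0" for x by (simp add: dir_deriv_def)
    then show "dir_deriv ((0, w), 0) (\<lambda>z. f (fst (fst z), snd z)) z = 0"
      by (simp add: dir_deriv_compose_linear[OF L(1) that] zero_prod_def[symmetric])
  qed
  note b = C1_compose_linear[OF L(2)] dir_deriv_compose_linear[OF L(2)]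
  define F where "F z = a1 (fst (fst z), snd z) * b1 (snd (fst z), snd z)
    + a2 (fst (fst z), snd z) * b2 (snd (fst z), snd z)
    + a3 (fst (fst z), snd z) * b3 (snd (fst z), snd z)" for z
  have F: "C1 F" unfolding F_def[abs_def] by (intro C1_add C1_mult a b(1) C1)
  have K: "pairing = (\<lambda>x. N_integral (\<lambda>p. F (x, p)))"
    by (simp add: fun_eq_iff pairing_def F_def)
  show "C1 pairing" unfolding K by (rule C1_integral[OF F])
  have "dir_deriv ((0, 1), 0) F z = a1 (fst (fst z), snd z) * dir_deriv (1, 0) b1 (snd (fst z), snd z)
    + a2 (fst (fst z), snd z) * dir_deriv (1, 0) b2 (snd (fst z), snd z)
    + a3 (fst (fst z), snd z) * dir_deriv (1, 0) b3 (snd (fst z), snd z)" for z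
    unfolding F_def[abs_def] by (simp add: dir_deriv_add dir_deriv_mult C1_add C1_mult a b C1)
  then show "dir_deriv (0, 1) pairing (v, s) =
      N_integral (\<lambda>p. a1 (v, p) * dir_deriv (1, 0) b1 (s, p) + a2 (v, p) * dir_deriv (1, 0) b2 (s, p)
        + a3 (v, p) * dir_deriv (1, 0) b3 (s, p))"
    unfolding K dir_deriv_integral[OF F] by simp
qed

text \<open>Closedness replaces \<open>\<partial>\<^sub>s \<beta>\<^sub>s\<close> by
  \<open>d\<alpha>\<^sub>s\<close>, and Stokes' theorem exchanges the two 1-forms.\<close>

lemma pairing_deriv_symmetric: "dir_deriv (0, 1) pairing (v, s) = dir_deriv (0, 1) pairing (s, v)"
  unfolding pairing_deriv_eq closed
  by (rule N_integral_curl_symmetric) (intro C1_slice C1 inv)+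

text \<open>The exterior derivative of the average is the integral of
  \<open>\<partial>\<^sub>s \<beta>\<^sub>s\<close> over a period, which is zero because \<beta> is
  periodic.\<close>

lemma S_average_closed:
  "curl1 (S_average a2) (S_average a3) p = 0"
  "curl2 (S_average a1) (S_average a3) p = 0"
  "curl3 (S_average a1) (S_average a2) (S_average a3) p = 0"
proof -
  have b: "integral {0..1} (\<lambda>s. dir_deriv (1, 0) f (s, p)) = f (1, p) - f (0, p)" if "C1 f"
    for f :: "real \<times> real \<times> real \<times> real \<Rightarrow> real"
    using C1_integral_line[OF that, of "(1, 0)" "(0, p)"] by simp
  note i = frame_slice_integrable C1 Henstock_Kurzweil_Integration.integral_diff
    Henstock_Kurzweil_Integration.integral_add
    slice_integrable[OF C1_continuous[OF C1(3)]] integrable_diff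
  show "curl1 (S_average a2) (S_average a3) p = 0"
    using b[OF C1(4)] unfolding closed curl1_def by (simp add: S_average_frame i per)
  show "curl2 (S_average a1) (S_average a3) p = 0"
    using b[OF C1(5)] unfolding closed curl2_def by (simp add: S_average_frame i per)
  show "curl3 (S_average a1) (S_average a2) (S_average a3) p = 0"
    using b[OF C1(6)] unfolding closed curl3_def
    by (simp add: S_average_frame i per) (simp add: S_average_def)
qed

text \<open>With \<open>b1\<close> and \<open>b2\<close> zero on the slice \<open>s = 0\<close>, the
  equation \<open>div\<close> says that the fibre derivative of \<open>b3\<close> vanishes
  there.\<close>

lemma b3_fibre_const: "b3 (0, t, x, y) = b3 (0, t, x, 0)"
proof -
  have z: "(\<lambda>p. b1 (0, p)) = (\<lambda>p. 0)" "(\<lambda>p. b2 (0, p)) = (\<lambda>p. 0)"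
    using fibre by auto
  have "dir_deriv v (\<lambda>p. 0) = (\<lambda>p. 0)" for v :: "real \<times> real \<times> real"
    by (simp add: dir_deriv_def fun_eq_iff)
  then have "dir_deriv (0, 0, 1) (\<lambda>p. b3 (0, p)) p = 0" for p
    using div[of p] unfolding z by (simp add: NT_def NX_def NY_def)
  from C1_zero_dir_deriv_const[OF C1_slice[OF C1(6)] this, of "(t, x, 0)" y]
  show ?thesis by simp
qed

text \<open>At \<open>s = 0\<close> only the \<open>b3\<close> term survives. Exchanging the
  integrals averages \<open>a3\<close>, and \<open>b3\<close>, being constant on fibres, serves as
  the weight \<open>c\<close> of \<open>N_integral_closed_fibre_const\<close>.\<close>

lemma integral_pairing_zero: "integral {0..1} (\<lambda>v. pairing (v, 0)) = 0"
proof -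
  have c: "continuous_on UNIV (\<lambda>p. b3 (0, p))" by (rule C1_continuous[OF C1_slice[OF C1(6)]])
  have inv': "N_invariant (S_average a1)" "N_invariant (S_average a2)" "N_invariant (S_average a3)"
    using inv unfolding N_invariant_def S_average_def by simp_all
  have c': "continuous_on UNIV (\<lambda>(v, p). b3 (0, p) * a3 (v, p))"
    unfolding case_prod_beta
    by (intro continuous_intros continuous_on_compose2[OF c] C1_continuous C1(3)) (auto simp: C1)
  have "integral {0..1} (\<lambda>v. pairing (v, 0)) =
      integral (cbox 0 1) (\<lambda>v. N_integral (\<lambda>p. b3 (0, p) * a3 (v, p)))"
    by (simp add: pairing_def fibre mult.commute)
  also have "\<dots> = N_integral (\<lambda>p. integral (cbox 0 1) (\<lambda>v. b3 (0, p) * a3 (v, p)))"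
    by (rule integral_swap_continuous) (rule continuous_on_subset[OF c'], simp)
  also have "\<dots> = N_integral (\<lambda>p. b3 (0, p) * S_average a3 p)"
    by (simp add: S_average_def)
  also have "\<dots> = 0"
    by (rule N_integral_closed_fibre_const[OF C1_S_average C1_S_average C1_S_average inv'
          S_average_closed c b3_fibre_const]) (rule C1)+
  finally show ?thesis .
qed

text \<open>The primitive \<open>G s = \<integral>\<^sub>0\<^sup>s pairing (v, s) + pairing (v, 0) dv\<close> has derivative
  \<open>2 * pairing (s, s)\<close> by symmetry of the derivative of the pairing, and \<open>G 0 = G 1 = 0\<close>.\<close>

lemma pairing_diagonal_zero: "\<exists>s. pairing (s, s) = 0"
proof -
  define G where "G s = integral {0..s} (\<lambda>v. pairing (v, s)) + integral {0..s} (\<lambda>v. pairing (v, 0))" for s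
  have D: "(G has_real_derivative 2 * pairing (s, s)) (at s within {0..1})" if s: "s \<in> {0..1}" for s
  proof -
    \<comment> \<open>Symmetry moves the derivative onto the variable of integration, so the
      fundamental theorem of calculus applies.\<close>
    have "integral {0..s} (\<lambda>v. dir_deriv (0, 1) pairing (v, s)) =
        integral {0..s} (\<lambda>v. dir_deriv (0, 1) pairing (s, v))"
      using pairing_deriv_symmetric by simp
    also have "((\<lambda>v. dir_deriv (0, 1) pairing (s, v)) has_integral pairing (s, s) - pairing (s, 0)) {0..s}"
    proof (rule fundamental_theorem_of_calculus)
      show "((\<lambda>v. pairing (s, v)) has_vector_derivative dir_deriv (0, 1) pairing (s, v)) (at v within {0..s})" for v
        using C1_has_dir_deriv[OF C1_pairing, of "(s, 0)" "(0, 1)" v]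
        by (simp add: has_real_derivative_iff_has_vector_derivative)
    qed (use s in auto)
    then have "integral {0..s} (\<lambda>v. dir_deriv (0, 1) pairing (s, v)) = pairing (s, s) - pairing (s, 0)"
      by (rule integral_unique)
    finally have 1: "integral {0..s} (\<lambda>v. dir_deriv (0, 1) pairing (v, s)) = pairing (s, s) - pairing (s, 0)" .
    have "continuous_on {0..1} (\<lambda>v. pairing (v, 0))"
      by (intro continuous_on_compose2[OF C1_continuous[OF C1_pairing, of UNIV]] continuous_intros) simp
    \<comment> \<open>The second summand of \<open>G\<close> contributes
      \<open>pairing (s, 0)\<close>, which cancels the boundary term in 1.\<close>
    from DERIV_add[OF has_real_derivative_integral_upto[OF C1_pairing s] integral_has_real_derivative[OF this s]]
    show ?thesis unfolding G_def[abs_def] 1 by simp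
  qed
  \<comment> \<open>By this periodicity \<open>G 1\<close> is twice the integral of
    \<open>pairing (v, 0)\<close>.\<close>
  have "pairing (v, 1) = pairing (v, 0)" for v
    by (simp add: pairing_def per)
  then have "G 0 = 0" "G 1 = 0" by (simp_all add: G_def integral_pairing_zero)
  moreover have "\<exists>s\<in>{0..1}. G 1 - G 0 = 2 * pairing (s, s) * (1 - 0)"
    by (rule mvt_very_simple) (use D in \<open>auto simp: has_field_derivative_def\<close>)
  ultimately show ?thesis by auto
qed

text \<open>A diagonal value \<open>pairing (s, s) = 0\<close> is the integral of this expression
  over a slice, so the integrand has a zero.\<close>

lemma pfaffian_vanishes: "\<exists>z. a1 z * b1 z + a2 z * b2 z + a3 z * b3 z = 0"
proof -
  obtain s where s: "pairing (s, s) = 0" using pairing_diagonal_zero by blast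
  have "continuous_on UNIV (\<lambda>p. a1 (s, p) * b1 (s, p) + a2 (s, p) * b2 (s, p) + a3 (s, p) * b3 (s, p))"
    by (intro continuous_intros C1_continuous C1_slice C1)
  from N_integral_nonzero[OF this] s show ?thesis
    unfolding pairing_def by auto
qed

end

section \<open>Lifting forms to the universal covers\<close>

text \<open>This passes from the Frechet derivatives of \<open>smooth_on\<close> to derivatives
  along lines, through \<open>Ck_on\<close> at level 1.\<close>

lemma
  assumes "smooth_on UNIV f"
  shows smooth_on_imp_C1: "C1 f"
    and dir_deriv_frechet: "dir_deriv v f z = frechet_derivative f (at z) v"
proof -
  have "Ck_on 1 UNIV f" using assms unfolding smooth_on_def by blast
  then have d: "f differentiable (at z)" and c: "continuous_on UNIV (\<lambda>x. frechet_derivative f (at x) v)" for z v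
    by auto
  have "(f has_derivative frechet_derivative f (at z)) (at z)" for z
    using d by (simp add: frechet_derivative_works)
  then have "((\<lambda>r. f (z + r *\<^sub>R v)) has_derivative (\<lambda>h. frechet_derivative f (at z) (h *\<^sub>R v))) (at 0)" for z v
    by (intro has_derivative_compose[where f = "\<lambda>r. z + r *\<^sub>R v" and g = f])
      (auto intro!: derivative_eq_intros)
  moreover have "frechet_derivative f (at z) (h *\<^sub>R v) = frechet_derivative f (at z) v * h" for z v h
    using linear_frechet_derivative[OF d[of z]] by (simp add: linear_cmul)
  ultimately have e: "((\<lambda>r. f (z + r *\<^sub>R v)) has_real_derivative frechet_derivative f (at z) v) (at 0)" for z v
    by (simp add: has_field_derivative_def)
  have "continuous_on UNIV f"
    using d by (intro continuous_at_imp_continuous_on ballI differentiable_imp_continuous_within)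
  note C1I[of f "\<lambda>v z. frechet_derivative f (at z) v", OF this c e]
  then show "C1 f" "dir_deriv v f z = frechet_derivative f (at z) v" by blast+
qed

lemma frechet_derivative_cong_open:
  assumes "open W" "z \<in> W" "\<And>x. x \<in> W \<Longrightarrow> f x = g x" "f differentiable (at z)"
  shows "frechet_derivative g (at z) = frechet_derivative f (at z)"
proof -
  have "(f has_derivative frechet_derivative f (at z)) (at z)"
    using assms(4) by (simp add: frechet_derivative_works)
  then have "(g has_derivative frechet_derivative f (at z)) (at z)"
    by (rule has_derivative_transform_within_open[OF _ assms(1-3)])
  then show ?thesis by (metis frechet_derivative_at)
qed

text \<open>A continuous lift \<open>A\<close> of \<open>G\<close> through the chart agrees near
  \<open>p\<close> with the coordinate expression of \<open>G\<close>, so it computes the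
  derivative. The lifts used below are affine.\<close>

lemma inv_chart_derivative:
  assumes V: "open V" "inj_on \<psi> V" and A: "continuous_on UNIV A" "(A has_derivative L) (at p)" "A p \<in> V"
    and lift: "\<And>x. \<psi> (A x) = G x"
  shows "(inv_into V \<psi> \<circ> G) p = A p" and "frechet_derivative (inv_into V \<psi> \<circ> G) (at p) = L"
proof -
  have eq: "(inv_into V \<psi> \<circ> G) x = A x" if "x \<in> A -` V" for x
    using that V(2) by (auto simp: lift[symmetric])
  show "(inv_into V \<psi> \<circ> G) p = A p" using eq A(3) by simp
  have "open (A -` V)" by (rule open_vimage[OF V(1) A(1)])
  then have "((inv_into V \<psi> \<circ> G) has_derivative L) (at p)"
    by (rule has_derivative_transform_within_open[OF A(2)]) (use A(3) eq in auto)
  then show "frechet_derivative (inv_into V \<psi> \<circ> G) (at p) = L" by (metis frechet_derivative_at)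
qed

text \<open>A chart covering \<open>q z\<close> may be based at another preimage \<open>u\<close>;
  the deck map \<open>g\<close> with \<open>g z = u\<close> pulls its domain back to a neighbourhood
  of \<open>z\<close>.\<close>

lemma quotient_chart_at:
  fixes q :: "'e::euclidean_space \<Rightarrow> 'm"
  assumes "smooth_atlas UNIV (quotient_atlas q)"
    and deck: "\<And>x y. q x = q y \<Longrightarrow> \<exists>g. continuous_on UNIV g \<and> inj g \<and> (\<forall>z. q (g z) = q z) \<and> g x = y"
  shows "\<exists>U. (U, q) \<in> quotient_atlas q \<and> z \<in> U"
proof -
  have "q z \<in> (\<Union>(U, \<phi>)\<in>quotient_atlas q. \<phi> ` U)" using assms(1) unfolding smooth_atlas_def by simp
  then obtain U u where U: "open U" "inj_on q U" "u \<in> U" "q z = q u"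
    unfolding quotient_atlas_def by auto
  obtain g where g: "continuous_on UNIV g" "inj g" "\<And>z. q (g z) = q z" "g z = u"
    using deck[OF U(4)] by blast
  have "inj_on q (g -` U)"
  proof (rule inj_onI)
    fix x y assume "x \<in> g -` U" "y \<in> g -` U" "q x = q y"
    then have "g x = g y" using U(2) g(3) by (metis inj_onD vimageE)
    then show "x = y" using g(2) by (simp add: inj_eq)
  qed
  moreover have "open (g -` U)" by (rule open_vimage[OF U(1) g(1)])
  moreover have "z \<in> g -` U" using g(4) U(3) by simp
  ultimately show ?thesis unfolding quotient_atlas_def by blast
qed

section \<open>Deck transformations and charts of the quotients\<close>

definition N_shear :: "int \<Rightarrow> real \<times> real \<times> real \<Rightarrow> real \<times> real \<times> real" where
  "N_shear k p = (fst p, fst (snd p), snd (snd p) - of_int k * fst (snd p))"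

definition X_shear :: "int \<Rightarrow> real \<times> real \<times> real \<times> real \<Rightarrow> real \<times> real \<times> real \<times> real" where
  "X_shear k z = (fst z, N_shear k (snd z))"

text \<open>The deck transformations of \<open>X_quot\<close>; only \<open>k\<close> enters the
  linear part, which is also the derivative.\<close>

definition X_deck :: "int \<Rightarrow> int \<Rightarrow> int \<Rightarrow> int \<Rightarrow> real \<times> real \<times> real \<times> real \<Rightarrow> real \<times> real \<times> real \<times> real" where
  "X_deck j k m n z = X_shear k z + (of_int j, of_int k, of_int m, of_int n)"

abbreviation X_quot :: "real \<times> real \<times> real \<times> real \<Rightarrow> circle \<times> N" where
  "X_quot \<equiv> map_prod abs_circle abs_N"

lemma bounded_linear_N_shear: "bounded_linear (N_shear k)"
  unfolding linear_conv_bounded_linear[symmetric] N_shear_def[abs_def]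
  by (rule linearI) (auto simp: algebra_simps)

lemma bounded_linear_X_shear: "bounded_linear (X_shear k)"
  unfolding X_shear_def[abs_def]
  by (intro bounded_linear_Pair bounded_linear_fst bounded_linear_compose[OF bounded_linear_N_shear] bounded_linear_snd)

lemma X_shear_0: "X_shear 0 z = z"
  by (simp add: X_shear_def N_shear_def)

lemma abs_N_deck: "abs_N (N_shear k p + (of_int k, of_int m, of_int n)) = abs_N p"
  using equivclp_N_gluing_shift[of "fst p" k "fst (snd p)" m "snd (snd p)" n]
  by (simp add: N.abs_eq_iff N_shear_def algebra_simps)

lemma abs_N_eqE:
  assumes "abs_N q = abs_N p"
  obtains k m n where "q = N_shear k p + (of_int k, of_int m, of_int n)"
proof -
  obtain t x y where p: "p = (t, x, y)" by (cases p)
  have "equivclp N_gluing q (t, x, y)" using assms by (simp add: N.abs_eq_iff p)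
  then show thesis by (rule equivclp_N_gluingE) (use that in \<open>simp add: p N_shear_def\<close>)
qed

lemma abs_circle_add_int: "abs_circle (s + of_int j) = abs_circle s"
  by (simp add: circle.abs_eq_iff circle_rel_def)

lemma abs_circle_eqE:
  assumes "abs_circle t = abs_circle s"
  obtains j where "t = s + of_int j"
proof -
  have "t - s \<in> \<int>" using assms by (simp add: circle.abs_eq_iff circle_rel_def)
  then obtain j where "t - s = of_int j" by (rule Ints_cases)
  then show thesis by (intro that[of j]) simp
qed

lemma X_quot_deck: "X_quot (X_deck j k m n z) = X_quot z"
  using abs_N_deck[of k "snd z" m n] abs_circle_add_int[of "fst z" j]
  by (cases z) (simp add: X_deck_def X_shear_def)

lemma X_quot_eqE:
  assumes "X_quot w = X_quot z"
  obtains j k m n where "w = X_deck j k m n z"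
proof -
  obtain s p s' p' where zw: "z = (s, p)" "w = (s', p')" by (cases z, cases w)
  with assms have "abs_circle s' = abs_circle s" "abs_N p' = abs_N p" by auto
  then obtain j k m n where "s' = s + of_int j" "p' = N_shear k p + (of_int k, of_int m, of_int n)"
    by (metis abs_circle_eqE abs_N_eqE)
  then show thesis by (intro that[of j k m n]) (simp add: zw X_deck_def X_shear_def)
qed

lemma continuous_on_X_deck: "continuous_on S (X_deck j k m n)"
  unfolding X_deck_def[abs_def]
  by (intro continuous_intros linear_continuous_on bounded_linear_X_shear)

lemma has_derivative_X_deck: "(X_deck j k m n has_derivative X_shear k) (at z)"
  unfolding X_deck_def[abs_def]
  by (intro has_derivative_add_const bounded_linear_imp_has_derivative bounded_linear_X_shear)

lemma circle_chart_at: "\<exists>U. (U, abs_circle) \<in> circle_atlas \<and> z \<in> U"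
  unfolding circle_atlas_def
proof (rule quotient_chart_at)
  show "smooth_atlas UNIV (quotient_atlas abs_circle)"
    using smooth_atlas_circle by (simp add: circle_atlas_def)
  show "\<exists>g. continuous_on UNIV g \<and> inj g \<and> (\<forall>z. abs_circle (g z) = abs_circle z) \<and> g x = y"
    if xy: "abs_circle x = abs_circle y" for x y
  proof -
    obtain j where "y = x + of_int j" using abs_circle_eqE[OF xy[symmetric]] by blast
    then show ?thesis
      by (intro exI[of _ "\<lambda>z. z + of_int j"])
        (auto intro!: continuous_intros injI simp: abs_circle_add_int)
  qed
qed

lemma N_chart_at: "\<exists>U. (U, abs_N) \<in> N_atlas \<and> z \<in> U"
  unfolding N_atlas_def
proof (rule quotient_chart_at)
  show "smooth_atlas UNIV (quotient_atlas abs_N)"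
    using smooth_atlas_N by (simp add: N_atlas_def)
  show "\<exists>g. continuous_on UNIV g \<and> inj g \<and> (\<forall>z. abs_N (g z) = abs_N z) \<and> g x = y"
    if xy: "abs_N x = abs_N y" for x y
  proof -
    obtain k m n where "y = N_shear k x + (of_int k, of_int m, of_int n)"
      using abs_N_eqE[OF xy[symmetric]] by blast
    moreover have "continuous_on UNIV (\<lambda>z. N_shear k z + (of_int k, of_int m, of_int n))"
      by (intro continuous_intros linear_continuous_on bounded_linear_N_shear)
    moreover have "inj (\<lambda>z. N_shear k z + (of_int k, of_int m, of_int n))"
      by (rule injI) (auto simp: N_shear_def prod_eq_iff)
    ultimately show ?thesis using abs_N_deck by blast
  qed
qed

lemma X_chart_at: "\<exists>W. (W, X_quot) \<in> X_atlas \<and> z \<in> W"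
proof -
  obtain s p where z: "z = (s, p)" by (cases z)
  obtain U V where "(U, abs_circle) \<in> circle_atlas" "s \<in> U" "(V, abs_N) \<in> N_atlas" "p \<in> V"
    using circle_chart_at[of s] N_chart_at[of p] by blast
  then have "(U \<times> V, X_quot) \<in> X_atlas" "z \<in> U \<times> V"
    unfolding X_atlas_def prod_atlas_def z by auto
  then show ?thesis by blast
qed

text \<open>All charts of \<open>X\<close> restrict the one map \<open>X_quot\<close>, so a chart is
  determined by its domain.\<close>

lemma X_atlasD:
  assumes "(W, \<psi>) \<in> X_atlas"
  shows "\<psi> = X_quot" "open W" "inj_on \<psi> W"
  using assms smooth_atlas_X unfolding smooth_atlas_def
  by (auto simp: X_atlas_def prod_atlas_def circle_atlas_def N_atlas_def quotient_atlas_def)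

lemma T2_atlasD:
  assumes "(W, \<psi>) \<in> T2_atlas"
  shows "\<psi> = map_prod abs_circle abs_circle" "open W" "inj_on \<psi> W"
  using assms smooth_atlas_T2 unfolding smooth_atlas_def
  by (auto simp: T2_atlas_def prod_atlas_def circle_atlas_def quotient_atlas_def)

section \<open>The lift of a symplectic form on \<open>X\<close> to the universal cover\<close>

locale symplectic_X =
  fixes \<omega> :: "(real \<times> real \<times> real \<times> real, circle \<times> N) form"
  assumes symplectic: "symplectic_form X_atlas \<omega>"
begin

definition chart_dom :: "real \<times> real \<times> real \<times> real \<Rightarrow> (real \<times> real \<times> real \<times> real) set" where
  "chart_dom z = (SOME W. (W, X_quot) \<in> X_atlas \<and> z \<in> W)"

text \<open>The pullback of \<omega> to the cover; \<open>\<Omega>_chart\<close> shows that the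
  choice of chart domain is immaterial.\<close>

definition \<Omega> :: "(real \<times> real \<times> real \<times> real) local_form" where
  "\<Omega> z = \<omega> (chart_dom z, X_quot) z"

lemma chart_dom: "(chart_dom z, X_quot) \<in> X_atlas" "z \<in> chart_dom z"
  using someI_ex[OF X_chart_at[of z]] unfolding chart_dom_def by blast+

text \<open>Near \<open>z\<close> the transition map between the two charts is the deck
  transformation itself.\<close>

lemma form_deck:
  assumes U: "(U, X_quot) \<in> X_atlas" "z \<in> U" and V: "(V, X_quot) \<in> X_atlas" "X_deck j k m n z \<in> V"
  shows "\<omega> (U, X_quot) z u v = \<omega> (V, X_quot) (X_deck j k m n z) (X_shear k u) (X_shear k v)"
proof -
  note inv = inv_chart_derivative[OF X_atlasD(2,3)[OF V(1)] continuous_on_X_deck has_derivative_X_deck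
      V(2) X_quot_deck]
  have z: "z \<in> U \<inter> X_quot -` (X_quot ` V)"
    using U(2) V(2) by (metis IntI X_quot_deck image_eqI vimageI)
  have two: "two_form X_atlas \<omega>" using symplectic by (simp add: symplectic_form_def)
  have "\<omega> (U, X_quot) z = local_pullback (inv_into V X_quot \<circ> X_quot) (\<omega> (V, X_quot)) z"
    by (rule two[unfolded two_form_def, THEN conjunct2, THEN bspec, OF U(1), unfolded case_prod_conv,
          THEN bspec, OF V(1), unfolded case_prod_conv, THEN bspec, OF z])
  then show ?thesis unfolding local_pullback_def inv by simp
qed

lemma \<Omega>_chart:
  assumes "(W, X_quot) \<in> X_atlas" "z \<in> W"
  shows "\<omega> (W, X_quot) z = \<Omega> z"
proof -
  have "X_deck 0 0 0 0 z = z" by (simp add: X_deck_def X_shear_0 zero_prod_def[symmetric])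
  then show ?thesis
    using form_deck[OF assms chart_dom(1), of 0 0 0 0] chart_dom(2)[of z]
    by (simp add: fun_eq_iff \<Omega>_def X_shear_0)
qed

lemma \<Omega>_deck: "\<Omega> (X_deck j k m n z) (X_shear k u) (X_shear k v) = \<Omega> z u v"
  using form_deck[OF chart_dom chart_dom] by (simp add: \<Omega>_def)

lemma \<Omega>_bilinear: "bilinear (\<Omega> z)"
  and \<Omega>_alternating: "\<Omega> z u u = 0"
  and \<Omega>_nondegenerate: "(\<And>v. \<Omega> z u v = 0) \<Longrightarrow> u = 0"
  using symplectic chart_dom[of z]
  unfolding symplectic_form_def two_form_def nondegenerate_form_def \<Omega>_def by blast+

lemma chart_smooth:
  assumes "(W, X_quot) \<in> X_atlas"
  shows "smooth_on W (\<lambda>z. \<omega> (W, X_quot) z u v)"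
  using symplectic assms unfolding symplectic_form_def two_form_def by blast

text \<open>Smoothness is local, and on the whole of \<open>chart_dom z\<close> the form \<Omega> is
  the expression of \<omega> in that single chart.\<close>

lemma \<Omega>_smooth: "smooth_on UNIV (\<lambda>z. \<Omega> z u v)"
  unfolding smooth_on_def
proof (intro allI Ck_on_local)
  fix k z
  note W = chart_dom[of z]
  have "Ck_on k (chart_dom z) (\<lambda>z. \<Omega> z u v)"
    by (rule Ck_on_cong[OF X_atlasD(2)[OF W(1)] _ chart_smooth[OF W(1), unfolded smooth_on_def, rule_format]])
      (simp add: \<Omega>_chart[OF W(1)])
  then show "\<exists>T. open T \<and> z \<in> T \<and> Ck_on k T (\<lambda>z. \<Omega> z u v)"
    using W X_atlasD(2) by blast
qed auto

lemmas \<Omega>_C1 = smooth_on_imp_C1[OF \<Omega>_smooth]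

lemma \<Omega>_closed:
  "dir_deriv u (\<lambda>z. \<Omega> z v w) z - dir_deriv v (\<lambda>z. \<Omega> z u w) z + dir_deriv w (\<lambda>z. \<Omega> z u v) z = 0"
proof -
  note W = chart_dom[of z]
  have d: "(\<lambda>z. \<Omega> z u v) differentiable (at z)" for u v
    using \<Omega>_smooth[of u v] unfolding smooth_on_def by (metis Ck_on.simps(2) UNIV_I)
  \<comment> \<open>The separate name \<open>z'\<close> keeps the chart fixed while the base point
    is differentiated.\<close>
  have "frechet_derivative (\<lambda>z. \<omega> (chart_dom z', X_quot) z u v) (at z) = frechet_derivative (\<lambda>z. \<Omega> z u v) (at z)"
    if "z' = z" for u v z'
    unfolding that
    by (rule frechet_derivative_cong_open[OF X_atlasD(2)[OF W(1)] W(2) _ d]) (simp add: \<Omega>_chart[OF W(1)])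
  moreover have "local_ext_deriv (\<omega> (chart_dom z, X_quot)) z u v w = 0"
    using symplectic W unfolding symplectic_form_def closed_form_def by blast
  ultimately show ?thesis
    by (simp add: local_ext_deriv_def dir_deriv_frechet[OF \<Omega>_smooth])
qed

lemma \<Omega>_skew: "\<Omega> z u v = - \<Omega> z v u"
  using \<Omega>_alternating[of z "u + v"]
  unfolding bilinear_ladd[OF \<Omega>_bilinear] bilinear_radd[OF \<Omega>_bilinear]
  by (simp add: \<Omega>_alternating)

text \<open>Whatever chart \<open>form_pullback\<close> chooses, the inclusion lifts to
  \<open>p \<mapsto> (0, p)\<close> followed by a deck transformation, which
  \<open>\<Omega>_deck\<close> removes.\<close>

lemma pullback_to_Y:
  "form_pullback X_atlas Y_incl \<omega> (V, Pair (abs_circle 0) \<circ> abs_N) p u v = \<Omega> (0, p) (0, u) (0, v)"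
proof -
  let ?P = "\<lambda>c. c \<in> X_atlas \<and> Y_incl ((Pair (abs_circle 0) \<circ> abs_N) p) \<in> snd c ` fst c"
  obtain W \<psi> where c: "(SOME c. ?P c) = (W, \<psi>)" by fastforce
  have "?P (chart_dom (0, p), X_quot)"
    using chart_dom[of "(0, p)"] by (auto simp: Y_incl_def intro!: image_eqI[of _ _ "(0, p)"])
  then have "?P (W, \<psi>)" unfolding c[symmetric] by (rule someI)
  then have W: "(W, X_quot) \<in> X_atlas" and "(abs_circle 0, abs_N p) \<in> \<psi> ` W" and psi: "\<psi> = X_quot"
    using X_atlasD(1) by (auto simp: Y_incl_def)
  then obtain w where w: "w \<in> W" "X_quot w = X_quot (0, p)" by auto
  then obtain j k m n where deck: "w = X_deck j k m n (0, p)" using X_quot_eqE by blast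
  \<comment> \<open>The chosen domain need not contain \<open>(0, p)\<close>, only the translate
    \<open>w\<close>; \<open>A\<close> is the lift landing there.\<close>
  define A where "A p = X_deck j k m n (0, p)" for p
  have A: "continuous_on UNIV A"
    unfolding A_def by (intro continuous_on_compose2[OF continuous_on_X_deck[of UNIV]] continuous_intros) simp
  have "((\<lambda>p. (0, p)) has_derivative (\<lambda>p. (0::real, p))) (at p)"
    by (intro has_derivative_Pair has_derivative_const has_derivative_ident)
  then have dA: "(A has_derivative (\<lambda>u. X_shear k (0, u))) (at p)"
    unfolding A_def using has_derivative_X_deck by (rule has_derivative_compose)
  have lift: "X_quot (A x) = (Y_incl \<circ> (Pair (abs_circle 0) \<circ> abs_N)) x" for x
    unfolding A_def X_quot_deck by (simp add: Y_incl_def)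
  have Ap: "A p = X_deck j k m n (0, p)" "A p \<in> W" using w deck by (simp_all add: A_def)
  note inv = inv_chart_derivative[OF X_atlasD(2,3)[OF W] A dA Ap(2) lift]
  have "form_pullback X_atlas Y_incl \<omega> (V, Pair (abs_circle 0) \<circ> abs_N) p =
      local_pullback (inv_into W X_quot \<circ> (Y_incl \<circ> (Pair (abs_circle 0) \<circ> abs_N))) (\<omega> (W, X_quot)) p"
    unfolding form_pullback_def case_prod_conv c by (simp add: psi comp_assoc)
  then show ?thesis
    unfolding local_pullback_def inv \<Omega>_chart[OF W Ap(2)] unfolding Ap(1) \<Omega>_deck by simp
qed

end

text \<open>The projection forgets \<open>y\<close>, so the derivative of its lift kills the fibre
  direction.\<close>

lemma pullback_from_T2_fibre:
  assumes \<sigma>: "two_form T2_atlas \<sigma>"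
  shows "form_pullback T2_atlas Y_proj \<sigma> (V, Pair (abs_circle 0) \<circ> abs_N) p (0, 0, 1) v = 0"
proof -
  let ?F = "Y_proj \<circ> (Pair (abs_circle 0) \<circ> abs_N)"
  let ?q = "map_prod abs_circle abs_circle"
  let ?P = "\<lambda>c. c \<in> T2_atlas \<and> Y_proj ((Pair (abs_circle 0) \<circ> abs_N) p) \<in> snd c ` fst c"
  obtain W \<psi> where c: "(SOME c. ?P c) = (W, \<psi>)" by fastforce
  have F: "?F x = ?q (fst x, fst (snd x))" for x
    by (cases x) (simp add: Y_proj_def N_proj.abs_eq)
  have "Y_proj ((Pair (abs_circle 0) \<circ> abs_N) p) \<in> (\<Union>(U, \<phi>)\<in>T2_atlas. \<phi> ` U)"
    using smooth_atlas_T2 unfolding smooth_atlas_def by simp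
  then have "\<exists>c. ?P c" by (force simp del: comp_apply)
  then have "?P (W, \<psi>)" unfolding c[symmetric] by (rule someI_ex)
  then have W: "(W, \<psi>) \<in> T2_atlas" and "?F p \<in> \<psi> ` W" by auto
  note psi = T2_atlasD(1)[OF W]
  obtain w where w: "w \<in> W" "?q w = ?q (fst p, fst (snd p))"
    using \<open>?F p \<in> \<psi> ` W\<close> unfolding F psi by auto
  then obtain i j where ij: "w = (fst p + of_int i, fst (snd p) + of_int j)"
    by (cases w) (auto elim!: abs_circle_eqE)
  \<comment> \<open>The integers \<open>i\<close> and \<open>j\<close> move the obvious lift into
    the chosen chart domain.\<close>
  define A where "A x = (fst x + of_int i, fst (snd x) + of_int j)" for x :: "real \<times> real \<times> real"
  have A: "continuous_on UNIV A" unfolding A_def by (intro continuous_intros)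
  have dA: "(A has_derivative (\<lambda>u. (fst u, fst (snd u)))) (at p)"
    unfolding A_def by (intro has_derivative_Pair has_derivative_add_const has_derivative_fst has_derivative_snd has_derivative_ident)
  have lift: "\<psi> (A x) = ?F x" for x
    unfolding F psi by (simp add: A_def abs_circle_add_int)
  have Aw: "A p = w" "A p \<in> W" using w by (simp_all add: A_def ij)
  note inv = inv_chart_derivative[OF T2_atlasD(2,3)[OF W] A dA Aw(2) lift]
  have "form_pullback T2_atlas Y_proj \<sigma> (V, Pair (abs_circle 0) \<circ> abs_N) p =
      local_pullback (inv_into W \<psi> \<circ> ?F) (\<sigma> (W, \<psi>)) p"
    unfolding form_pullback_def case_prod_conv c by (simp add: comp_assoc)
  moreover have "bilinear (\<sigma> (W, \<psi>) w)"
    using \<sigma> W w(1) unfolding two_form_def by blast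
  ultimately show ?thesis
    unfolding local_pullback_def inv Aw(1) by (simp add: zero_prod_def[symmetric] bilinear_lzero)
qed

lemma form_eq_vertical:
  assumes "symplectic_form X_atlas \<omega>" "symplectic_form T2_atlas \<sigma>"
    and eq: "form_eq Y_atlas (form_pullback X_atlas Y_incl \<omega>) (form_pullback T2_atlas Y_proj \<sigma>)"
  shows "symplectic_X.\<Omega> \<omega> (0, p) (0, 0, 0, 1) (0, v) = 0"
proof -
  interpret symplectic_X \<omega> by standard (rule assms(1))
  obtain V where V: "(V, abs_N) \<in> N_atlas" "p \<in> V" using N_chart_at by blast
  then have "(V, Pair (abs_circle 0) \<circ> abs_N) \<in> Y_atlas"
    unfolding Y_atlas_def image_atlas_def by blast
  then have "form_pullback X_atlas Y_incl \<omega> (V, Pair (abs_circle 0) \<circ> abs_N) p =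
      form_pullback T2_atlas Y_proj \<sigma> (V, Pair (abs_circle 0) \<circ> abs_N) p"
    using eq V(2) unfolding form_eq_def by blast
  then show ?thesis
    using pullback_to_Y[of V p "(0, 0, 1)" v] pullback_from_T2_fibre[of \<sigma> V p v] assms(2)
    by (simp add: symplectic_form_def)
qed

text \<open>The hypothesis \<open>pf\<close> is the vanishing of the Pfaffian, whose square is the
  Gram determinant; a kernel vector is exhibited explicitly.\<close>

lemma skew_bilinear_pfaffian_zero_degenerate:
  fixes B :: "real \<times> real \<times> real \<times> real \<Rightarrow> real \<times> real \<times> real \<times> real \<Rightarrow> real"
  assumes B: "bilinear B" and alt: "\<And>u. B u u = 0"
  defines "e0 \<equiv> (1, 0, 0, 0)" and "e1 \<equiv> (0, 1, 0, 0)" and "e2 \<equiv> (0, 0, 1, 0)" and "e3 \<equiv> (0, 0, 0, 1)"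
  assumes pf: "B e0 e1 * B e2 e3 - B e0 e2 * B e1 e3 + B e0 e3 * B e1 e2 = 0"
  shows "\<exists>u. u \<noteq> 0 \<and> (\<forall>v. B u v = 0)"
proof -
  have skew: "B y x = - B x y" for x y
    using alt[of "x + y"] unfolding bilinear_ladd[OF B] bilinear_radd[OF B] by (simp add: alt)
  have ex: "B (u0, u1, u2, u3) (v0, v1, v2, v3) =
      B e0 e1 * (u0 * v1 - u1 * v0) + B e0 e2 * (u0 * v2 - u2 * v0) + B e0 e3 * (u0 * v3 - u3 * v0)
    + B e1 e2 * (u1 * v2 - u2 * v1) + B e1 e3 * (u1 * v3 - u3 * v1) + B e2 e3 * (u2 * v3 - u3 * v2)"
    for u0 u1 u2 u3 v0 v1 v2 v3
  proof -
    have tup: "(u0, u1, u2, u3) = u0 *\<^sub>R e0 + u1 *\<^sub>R e1 + u2 *\<^sub>R e2 + u3 *\<^sub>R e3" for u0 u1 u2 u3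
      by (simp add: e0_def e1_def e2_def e3_def)
    have l: "B (u0, u1, u2, u3) w = u0 * B e0 w + u1 * B e1 w + u2 * B e2 w + u3 * B e3 w"
      and r: "B w (u0, u1, u2, u3) = u0 * B w e0 + u1 * B w e1 + u2 * B w e2 + u3 * B w e3" for u0 u1 u2 u3 w
      unfolding tup by (simp_all only: bilinear_ladd[OF B] bilinear_radd[OF B] bilinear_lmul[OF B] bilinear_rmul[OF B] real_scaleR_def)
    show ?thesis
      unfolding l[of u0 u1 u2 u3] r[of _ v0 v1 v2 v3]
      unfolding alt skew[of e0 e1] skew[of e0 e2] skew[of e0 e3]
        skew[of e1 e2] skew[of e1 e3] skew[of e2 e3]
      by (simp add: algebra_simps)
  qed
  have deg: "\<exists>u. u \<noteq> 0 \<and> (\<forall>v. B u v = 0)"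
    if "(u0, u1, u2, u3) \<noteq> (0, 0, 0, 0)" "\<And>v0 v1 v2 v3. B (u0, u1, u2, u3) (v0, v1, v2, v3) = 0" for u0 u1 u2 u3
    using that by (intro exI[of _ "(u0, u1, u2, u3)"]) (auto simp: zero_prod_def)
  define a b c d e f where "a = B e0 e1" and "b = B e0 e2" and "c = B e0 e3"
    and "d = B e1 e2" and "e = B e1 e3" and "f = B e2 e3"
  note ex' = ex[folded a_def b_def c_def d_def e_def f_def]
  have pf': "a * f = b * e - c * d" using pf by (simp add: a_def b_def c_def d_def e_def f_def)
  \<comment> \<open>candidate kernel vectors: rows of the Pfaffian adjugate of the Gram matrix\<close>
  consider "\<not> (d = 0 \<and> e = 0 \<and> f = 0)" | "\<not> (b = 0 \<and> c = 0 \<and> f = 0)"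
    | "\<not> (a = 0 \<and> c = 0 \<and> e = 0)" | "a = 0" "b = 0" "c = 0" "d = 0" "e = 0" "f = 0"
    by blast
  then show ?thesis
  proof cases
    case 1
    have "B (0, f, - e, d) (v0, v1, v2, v3) = v0 * (b * e - c * d - a * f)" for v0 v1 v2 v3
      unfolding ex' by (simp add: algebra_simps)
    then have "B (0, f, - e, d) (v0, v1, v2, v3) = 0" for v0 v1 v2 v3
      by (simp add: pf')
    then show ?thesis by (rule deg[rotated]) (use 1 in auto)
  next
    case 2
    have "B (- f, 0, c, - b) (v0, v1, v2, v3) = v1 * (b * e - c * d - a * f)" for v0 v1 v2 v3
      unfolding ex' by (simp add: algebra_simps)
    then have "B (- f, 0, c, - b) (v0, v1, v2, v3) = 0" for v0 v1 v2 v3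
      by (simp add: pf')
    then show ?thesis by (rule deg[rotated]) (use 2 in auto)
  next
    case 3
    have "B (e, - c, 0, a) (v0, v1, v2, v3) = v2 * (b * e - c * d - a * f)" for v0 v1 v2 v3
      unfolding ex' by (simp add: algebra_simps)
    then have "B (e, - c, 0, a) (v0, v1, v2, v3) = 0" for v0 v1 v2 v3
      by (simp add: pf')
    then show ?thesis by (rule deg[rotated]) (use 3 in auto)
  next
    case 4
    have "B (1, 0, 0, 0) (v0, v1, v2, v3) = 0" for v0 v1 v2 v3
      unfolding ex' using 4 by simp
    then show ?thesis by (intro deg[of 1 0 0 0]) auto
  qed
qed

text \<open>The coefficients of \<Omega> in the deck-invariant frame satisfy
  \<open>closed_coefficients\<close>, and the zero of the Pfaffian contradicts
  nondegeneracy.\<close>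

lemma (in symplectic_X) not_vertical_on_Y:
  assumes vert: "\<And>p v. \<Omega> (0, p) (0, 0, 0, 1) (0, v) = 0"
  shows False
proof -
  define eS eT eX eY :: "real \<times> real \<times> real \<times> real"
    where "eS = (1, 0, 0, 0)" and "eT = (0, 1, 0, 0)" and "eX = (0, 0, 1, 0)" and "eY = (0, 0, 0, 1)"
  define g where "g u v z = \<Omega> z u v" for u v z
  define \<tau> :: "real \<times> real \<times> real \<times> real \<Rightarrow> real" where "\<tau> z = fst (snd z)" for z
  \<comment> \<open>The values of \<Omega> on the frame \<open>eS\<close>, \<open>eT\<close>,
    \<open>eX - \<tau> eY\<close>, \<open>eY\<close>; in \<open>b1\<close> the correction drops out
    because \<open>g eY eY\<close> vanishes.\<close>
  define a1 a2 a3 b1 b2 b3 where "a1 = g eS eT" and "a2 = (\<lambda>z. g eS eX z - \<tau> z * g eS eY z)"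
    and "a3 = g eS eY" and "b1 = g eX eY" and "b2 = g eY eT"
    and "b3 = (\<lambda>z. g eT eX z - \<tau> z * g eT eY z)"
  note abdef = a1_def a2_def a3_def b1_def b2_def b3_def
  have g: "C1 (g u v)" for u v unfolding g_def[abs_def] by (rule \<Omega>_C1)
  have lt: "bounded_linear \<tau>"
    unfolding \<tau>_def[abs_def] by (intro bounded_linear_fst_comp bounded_linear_snd_comp bounded_linear_fst bounded_linear_snd)
  note \<tau> = C1_bounded_linear[OF lt] dir_deriv_bounded_linear[OF lt]
  have skew: "g u v z = - g v u z" for u v z unfolding g_def by (rule \<Omega>_skew)
  have closed: "dir_deriv u (g v w) z - dir_deriv v (g u w) z + dir_deriv w (g u v) z = 0" for u v w z
    unfolding g_def[abs_def] by (rule \<Omega>_closed)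
  have dskew: "dir_deriv w (g u v) z = - dir_deriv w (g v u) z" for u v w z
  proof -
    have eq: "g u v = (\<lambda>z. 0 - g v u z)" by (rule ext) (subst skew[of u v], simp)
    note zero = C1_bounded_linear[OF bounded_linear_zero] dir_deriv_bounded_linear[OF bounded_linear_zero]
    show ?thesis unfolding eq dir_deriv_diff[OF zero(1) g] zero(2) by simp
  qed
  have deck: "g (X_shear k u) (X_shear k v) (X_deck j k m n z) = g u v z" for j k m n u v z
    unfolding g_def by (rule \<Omega>_deck)
  have sh: "X_shear k eS = eS" "X_shear k eT = eT" "X_shear k eY = eY"
    "X_shear k eX = eX + (- of_int k) *\<^sub>R eY" for k
    by (simp_all add: X_shear_def N_shear_def eS_def eT_def eX_def eY_def)
  have gl: "g (u + r *\<^sub>R u') v z = g u v z + r * g u' v z" "g v (u + r *\<^sub>R u') z = g v u z + r * g v u' z"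
    for u u' v r z
    unfolding g_def
    by (simp_all add: bilinear_ladd[OF \<Omega>_bilinear] bilinear_radd[OF \<Omega>_bilinear]
        bilinear_lmul[OF \<Omega>_bilinear] bilinear_rmul[OF \<Omega>_bilinear])
  have gi: "g eS eT (X_deck j k m n z) = g eS eT z" "g eS eY (X_deck j k m n z) = g eS eY z"
    "g eT eY (X_deck j k m n z) = g eT eY z" "g eY eT (X_deck j k m n z) = g eY eT z"
    for j k m n z
    using deck[of k eS eT j m n z] deck[of k eS eY j m n z] deck[of k eT eY j m n z] deck[of k eY eT j m n z]
    unfolding sh by simp_all
  have gX: "g eS eX (X_deck j k m n z) = g eS eX z + k * g eS eY z"
    "g eT eX (X_deck j k m n z) = g eT eX z + k * g eT eY z"
    for j k m n z
    using deck[of k eS eX j m n z] deck[of k eT eX j m n z] unfolding sh gl gi by simp_all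
  have gYY: "g eY eY z = 0" for z unfolding g_def by (rule \<Omega>_alternating)
  have gXY: "g eX eY (X_deck j k m n z) = g eX eY z" for j k m n z
    using deck[of k eX eY j m n z] unfolding sh gl by (simp add: gYY)
  have \<tau>_deck: "\<tau> (X_deck j k m n z) = \<tau> z + of_int k" for j k m n z
    by (simp add: \<tau>_def X_deck_def X_shear_def N_shear_def)
  \<comment> \<open>The shear terms with \<open>k\<close> in \<open>gX\<close> are cancelled by the
    growth of \<tau> by \<open>k\<close>.\<close>
  have inv: "a1 (X_deck j k m n z) = a1 z" "a2 (X_deck j k m n z) = a2 z" "a3 (X_deck j k m n z) = a3 z"
    "b1 (X_deck j k m n z) = b1 z" "b2 (X_deck j k m n z) = b2 z" "b3 (X_deck j k m n z) = b3 z"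
    for j k m n z
    unfolding abdef gi gX gXY \<tau>_deck by (simp_all add: algebra_simps)
  have slice: "N_invariant (\<lambda>p. f (s, p))" and per: "f (1, p) = f (0, p)"
    if "\<And>j k m n z. f (X_deck j k m n z) = f z" for f :: "_ \<Rightarrow> real" and s p
  proof -
    show "N_invariant (\<lambda>p. f (s, p))"
      unfolding N_invariant_def
    proof (intro allI)
      fix t x y and k m n :: int
      show "f (s, t + of_int k, x + of_int m, y + of_int n - of_int k * x) = f (s, t, x, y)"
        using that[of 0 k m n "(s, t, x, y)"] by (simp add: X_deck_def X_shear_def N_shear_def algebra_simps)
    qed
    show "f (1, p) = f (0, p)"
      using that[of 1 0 0 0 "(0, p)"] by (simp add: X_deck_def X_shear_def N_shear_def zero_prod_def[symmetric])
  qed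
  have C1: "C1 a1" "C1 a2" "C1 a3" "C1 b1" "C1 b2" "C1 b3"
    unfolding abdef by (intro C1_diff C1_mult g \<tau>)+
  have frame: "NT (\<lambda>p. f (s, p)) p = dir_deriv eT f (s, p)" "NY (\<lambda>p. f (s, p)) p = dir_deriv eY f (s, p)"
    "NX (\<lambda>p. f (s, p)) p = dir_deriv eX f (s, p) - \<tau> (s, p) * dir_deriv eY f (s, p)"
    if "C1 f" for f s p
    by (simp_all add: NT_def NX_def NY_def dir_deriv_slice[OF that] eT_def eX_def eY_def \<tau>_def)
  have dS: "(1, 0) = eS" by (simp add: eS_def zero_prod_def)
  \<comment> \<open>The derivative 1 of \<tau> along \<open>eT\<close> is what the term
    \<open>a3\<close> in \<open>curl3\<close> compensates.\<close>
  have \<tau>e: "\<tau> eS = 0" "\<tau> eT = 1" "\<tau> eX = 0" "\<tau> eY = 0"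
    by (simp_all add: \<tau>_def eS_def eT_def eX_def eY_def)
  have d: "dir_deriv v a2 z = dir_deriv v (g eS eX) z - \<tau> v * g eS eY z - \<tau> z * dir_deriv v (g eS eY) z"
    "dir_deriv v b3 z = dir_deriv v (g eT eX) z - \<tau> v * g eT eY z - \<tau> z * dir_deriv v (g eT eY) z" for v z
    unfolding abdef by (simp_all add: dir_deriv_diff dir_deriv_mult C1_mult g \<tau>)
  have d': "dir_deriv v a1 z = dir_deriv v (g eS eT) z" "dir_deriv v a3 z = dir_deriv v (g eS eY) z"
    "dir_deriv v b1 z = dir_deriv v (g eX eY) z" "dir_deriv v b2 z = - dir_deriv v (g eT eY) z" for v z
    unfolding abdef by (simp_all add: dskew[of _ eY eT])
  have vert': "g eX eY (0, p) = 0" "g eY eT (0, p) = 0" for p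
    using vert[of p "(0, 1, 0)"] vert[of p "(1, 0, 0)"] skew[of eX eY "(0, p)"]
    by (simp_all add: g_def eX_def eY_def eT_def)
  interpret closed_coefficients a1 a2 a3 b1 b2 b3
  proof
    fix s :: real and p :: "real \<times> real \<times> real"
    let ?z = "(s, p)"
    show "dir_deriv (1, 0) b1 (s, p) = curl1 (\<lambda>p. a2 (s, p)) (\<lambda>p. a3 (s, p)) p"
      using closed[of eS eX eY ?z]
      unfolding curl1_def dS by (simp add: frame C1 d d' \<tau>e algebra_simps)
    show "dir_deriv (1, 0) b2 (s, p) = curl2 (\<lambda>p. a1 (s, p)) (\<lambda>p. a3 (s, p)) p"
      using closed[of eS eT eY ?z]
      unfolding curl2_def dS by (simp add: frame C1 d d' \<tau>e algebra_simps)
    show "dir_deriv (1, 0) b3 (s, p) = curl3 (\<lambda>p. a1 (s, p)) (\<lambda>p. a2 (s, p)) (\<lambda>p. a3 (s, p)) p"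
    proof -
      \<comment> \<open>Closedness is needed on two triples, since \<open>b3\<close> combines
        \<open>g eT eX\<close> with \<tau> times \<open>g eT eY\<close>.\<close>
      have 1: "dir_deriv eS (g eT eX) ?z = dir_deriv eT (g eS eX) ?z - dir_deriv eX (g eS eT) ?z"
        and 2: "dir_deriv eS (g eT eY) ?z = dir_deriv eT (g eS eY) ?z - dir_deriv eY (g eS eT) ?z"
        using closed[of eS eT eX ?z] closed[of eS eT eY ?z] by linarith+
      have 3: "a3 ?z = g eS eY ?z" by (simp add: a3_def)
      show ?thesis
        unfolding curl3_def dS by (simp add: frame C1 d d' \<tau>e 1 2 3 algebra_simps)
    qed
  next
    fix p :: "real \<times> real \<times> real"
    let ?z = "(0 :: real, p)"
    have "dir_deriv eT (g eX eY) ?z = dir_deriv eX (g eT eY) ?z - dir_deriv eY (g eT eX) ?z"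
      using closed[of eT eX eY ?z] by linarith
    then show "NT (\<lambda>p. b1 (0, p)) p + NX (\<lambda>p. b2 (0, p)) p + NY (\<lambda>p. b3 (0, p)) p = 0"
      by (simp add: frame C1 d d' \<tau>e algebra_simps)
    show "b1 (0, p) = 0" "b2 (0, p) = 0" by (simp_all add: b1_def b2_def vert')
    show "b1 (1, p) = b1 (0, p)" "b2 (1, p) = b2 (0, p)" "b3 (1, p) = b3 (0, p)"
      by (intro per inv)+
  next
    fix s :: real
    show "N_invariant (\<lambda>p. a1 (s, p))" "N_invariant (\<lambda>p. a2 (s, p))" "N_invariant (\<lambda>p. a3 (s, p))"
      by (intro slice inv)+
  qed (rule C1)+
  obtain z where z: "a1 z * b1 z + a2 z * b2 z + a3 z * b3 z = 0" using pfaffian_vanishes by blast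
  \<comment> \<open>The terms containing \<tau> cancel, leaving the Pfaffian in the constant
    frame.\<close>
  have "\<Omega> z eS eT * \<Omega> z eX eY - \<Omega> z eS eX * \<Omega> z eT eY + \<Omega> z eS eY * \<Omega> z eT eX = 0"
    using z unfolding abdef g_def \<Omega>_skew[of z eY eT] by (simp add: algebra_simps)
  from skew_bilinear_pfaffian_zero_degenerate[OF \<Omega>_bilinear \<Omega>_alternating this[unfolded eS_def eT_def eX_def eY_def]]
  show False using \<Omega>_nondegenerate by blast
qed

theorem proposition5p8:
  shows "\<not> (\<exists>\<omega>. symplectic_form X_atlas \<omega> \<and>
            (\<exists>\<sigma>. symplectic_form T2_atlas \<sigma> \<and>
                 form_eq Y_atlas (form_pullback X_atlas Y_incl \<omega>)
                                 (form_pullback T2_atlas Y_proj \<sigma>)))"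
proof (intro notI, elim exE conjE)
  fix \<omega> \<sigma>
  assume \<omega>: "symplectic_form X_atlas \<omega>" and "symplectic_form T2_atlas \<sigma>"
    and "form_eq Y_atlas (form_pullback X_atlas Y_incl \<omega>) (form_pullback T2_atlas Y_proj \<sigma>)"
  from form_eq_vertical[OF this] show False
    by (rule symplectic_X.not_vertical_on_Y[OF symplectic_X.intro[OF \<omega>]])
qed

end
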